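(* Let $\Bbbk$ be a field of characteristic different from $2$, $n\ge 2$, $\alpha\in\Bbbk$, and let $\mathcal{R}_a$ ($a\in\Bbbk$, $q\in\{0,1\}$) be one of the triangular structures on $A_{C_2^n}$ described in the context. Consider the infinitesimal $\mathcal{R}$-matrix $\chi_\alpha=\alpha\,x\otimes xg$ of $(A_{C_2^n},\mathcal{R}_a)$. Then $$\mathcal{R}_a\exp(\hbar\chi_\alpha)=\mathcal{R}_a(1\otimes 1+\hbar\chi_\alpha)$$ is a quasitriangular structure on the trivial topological bialgebra $A_{C_2^n}[[\hbar]]$.
   Context: $A_{C_2\times C_2}$ is the $8$-dimensional Hopf algebra generated as an algebra by $g,h,x$ with relations $g^2=h^2=1$, $x^2=0$, $gh=hg$, $gx=-xg$, $hx=-xh$, comultiplication $\Delta(g)=g\otimes g$, $\Delta(h)=h\otimes h$, $\Delta(x)=1\otimes x+x\otimes g$, counit $\varepsilon(g)=\varepsilon(h)=1$, $\varepsilon(x)=0$, antipode $S(g)=g$, $S(h)=h$, $S(x)=-xg$. For $n\ge 2$, $A_{C_2^n}$ is the $2^{n+1}$-dimensional Hopf algebra with coradical $\Bbbk C_2^n$ which is isomorphic to (Sweedler's $4$-dimensional Hopf algebra) $\otimes\,\Bbbk C_2^{n-1}$; equivalently, $A_{C_2^n}\cong A_{C_2\times C_2}\otimes\Bbbk C_2^{n-2}$ as Hopf algebras, via an isomorphism identifying $a\otimes 1$ with $a$ for all $a\in A_{C_2\times C_2}$. Thus $A_{C_2\times C_2}$ is regarded as a Hopf subalgebra of $A_{C_2^n}$.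 The triangular structures considered on $A_{C_2^n}$ are $$\mathcal{R}_a=\mathcal{R}_q(1\otimes 1+a\,x\otimes gx),\quad a\in\Bbbk,\ q\in\{0,1\},\qquad \mathcal{R}_q=\tfrac14\sum_{i,j,k,l=0}^{1}(-1)^{-ij-kl}\,g^ih^k\otimes g^{\,j+q(j+l)}h^{\,q(j+l)}.$$ For a bialgebra $H$ and $T=\sum_i T^i\otimes T_i\in H\otimes H$ write $T_{12}=T\otimes 1$, $T_{23}=1\otimes T$, $T_{13}=\sum_i T^i\otimes 1\otimes T_i$. For a quasitriangular bialgebra $(H,\mathcal{R})$, an infinitesimal $\mathcal{R}$-matrix is $\chi\in H\otimes H$ such that $\chi\Delta(h)=\Delta(h)\chi$ for all $h\in H$, $(\mathrm{Id}\otimes\Delta)(\chi)=\chi_{12}+\mathcal{R}_{12}^{-1}\chi_{13}\mathcal{R}_{12}$, and $(\Delta\otimes\mathrm{Id})(\chi)=\chi_{23}+\mathcal{R}_{23}^{-1}\chi_{13}\mathcal{R}_{23}$. The trivial topological bialgebra $H[[\hbar]]$ is the space of formal power series in $\hbar$ with coefficients in $H$, with the $\hbar$-linear extension of the bialgebra structure of $H$, where the tensor product is replaced by its completion, so that $H[[\hbar]]\hat\otimes H[[\hbar]]\cong(H\otimes H)[[\hbar]]$ (and similarly for three factors). A quasitriangular structure on $H[[\hbar]]$ is an invertible $\tilde{\mathcal{R}}\in(H\otimes H)[[\hbar]]$ with $\tilde{\mathcal{R}}\Delta(\cdot)=\Delta^{\mathrm{op}}(\cdot)\tilde{\mathcal{R}}$,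 $(\mathrm{Id}\otimes\Delta)(\tilde{\mathcal{R}})=\tilde{\mathcal{R}}_{13}\tilde{\mathcal{R}}_{12}$, $(\Delta\otimes\mathrm{Id})(\tilde{\mathcal{R}})=\tilde{\mathcal{R}}_{13}\tilde{\mathcal{R}}_{23}$. *)

theory Defs
  imports "HOL-Computational_Algebra.Formal_Power_Series" "HOL-Library.Cardinality"
begin

section \<open>Algebras with a finite basis, and their tensor products\<close>

text \<open>
  A type of class \<open>algebra_basis\<close> is a finite basis together with structure constants:
  \<open>bmult a b c\<close> is the coefficient of \<open>c\<close> in the product \<open>a b\<close>, and \<open>bunit c\<close> is the coefficient
  of \<open>c\<close> in the unit element.  Integral structure constants suffice for all the algebras needed here,
  and give an algebra over every commutative ring.
\<close>

class algebra_basis = finite +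
  fixes bmult :: "'a \<Rightarrow> 'a \<Rightarrow> 'a \<Rightarrow> int" and bunit :: "'a \<Rightarrow> int"
  assumes bmult_assoc: "(\<Sum>d\<in>UNIV. bmult a b d * bmult d c e) = (\<Sum>d\<in>UNIV. bmult b c d * bmult a d e)"
    and bunit_left: "(\<Sum>d\<in>UNIV. bunit d * bmult d a e) = of_bool (a = e)"
    and bunit_right: "(\<Sum>d\<in>UNIV. bunit d * bmult a d e) = of_bool (a = e)"

typedef ('b, 'k) alg = "UNIV :: ('b \<Rightarrow> 'k) set"
  morphisms coef Abs_alg by simp

setup_lifting type_definition_alg

lemma alg_eqI: "(\<And>b. coef u b = coef v b) \<Longrightarrow> u = v"
  by transfer auto

instantiation alg :: (type, ab_group_add) ab_group_add
begin
lift_definition zero_alg :: "('a, 'b) alg" is "\<lambda>_. 0" .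
lift_definition plus_alg :: "('a, 'b) alg \<Rightarrow> ('a, 'b) alg \<Rightarrow> ('a, 'b) alg" is "\<lambda>u v c. u c + v c" .
lift_definition minus_alg :: "('a, 'b) alg \<Rightarrow> ('a, 'b) alg \<Rightarrow> ('a, 'b) alg" is "\<lambda>u v c. u c - v c" .
lift_definition uminus_alg :: "('a, 'b) alg \<Rightarrow> ('a, 'b) alg" is "\<lambda>u c. - u c" .
instance by standard (transfer; auto simp: fun_eq_iff algebra_simps)+
end

instantiation alg :: (algebra_basis, comm_ring_1) ring_1
begin
lift_definition one_alg :: "('a, 'b) alg" is "\<lambda>c. of_int (bunit c)" .
lift_definition times_alg :: "('a, 'b) alg \<Rightarrow> ('a, 'b) alg \<Rightarrow> ('a, 'b) alg" is
  "\<lambda>u v c. \<Sum>a\<in>UNIV. \<Sum>b\<in>UNIV. of_int (bmult a b c) * u a * v b" .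
instance
proof
  fix u v w :: "('a, 'b) alg"
  show "u * v * w = u * (v * w)"
  proof (transfer, rule ext)
    fix u v w :: "'a \<Rightarrow> 'b" and e
    have "(\<Sum>d\<in>UNIV. \<Sum>c\<in>UNIV. of_int (bmult d c e)
            * (\<Sum>a\<in>UNIV. \<Sum>b\<in>UNIV. of_int (bmult a b d) * u a * v b) * w c)
        = (\<Sum>d\<in>UNIV. \<Sum>c\<in>UNIV. \<Sum>a\<in>UNIV. \<Sum>b\<in>UNIV.
            of_int (bmult a b d * bmult d c e) * (u a * v b * w c))"
      by (simp add: sum_distrib_left sum_distrib_right mult_ac)
    also have "\<dots> = (\<Sum>c\<in>UNIV. \<Sum>a\<in>UNIV. \<Sum>b\<in>UNIV. \<Sum>d\<in>UNIV.
            of_int (bmult a b d * bmult d c e) * (u a * v b * w c))"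
      by (subst sum.swap, rule sum.cong[OF refl], subst sum.swap, rule sum.cong[OF refl], rule sum.swap)
    also have "\<dots> = (\<Sum>c\<in>UNIV. \<Sum>a\<in>UNIV. \<Sum>b\<in>UNIV.
            of_int (\<Sum>d\<in>UNIV. bmult a b d * bmult d c e) * (u a * v b * w c))"
      by (simp add: sum_distrib_right)
    also have "\<dots> = (\<Sum>c\<in>UNIV. \<Sum>a\<in>UNIV. \<Sum>b\<in>UNIV.
            of_int (\<Sum>d\<in>UNIV. bmult b c d * bmult a d e) * (u a * v b * w c))"
      by (simp only: bmult_assoc)
    also have "\<dots> = (\<Sum>a\<in>UNIV. \<Sum>c\<in>UNIV. \<Sum>b\<in>UNIV. \<Sum>d\<in>UNIV.
            of_int (bmult b c d * bmult a d e) * (u a * v b * w c))"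
      by (subst sum.swap) (simp add: sum_distrib_right)
    also have "\<dots> = (\<Sum>a\<in>UNIV. \<Sum>d\<in>UNIV. \<Sum>b\<in>UNIV. \<Sum>c\<in>UNIV.
            of_int (bmult b c d * bmult a d e) * (u a * v b * w c))"
    proof (rule sum.cong[OF refl])
      fix a
      let ?f = "\<lambda>b c d. of_int (bmult b c d * bmult a d e) * (u a * v b * w c)"
      have "(\<Sum>c\<in>UNIV. \<Sum>b\<in>UNIV. \<Sum>d\<in>UNIV. ?f b c d) = (\<Sum>b\<in>UNIV. \<Sum>c\<in>UNIV. \<Sum>d\<in>UNIV. ?f b c d)"
        by (rule sum.swap)
      also have "\<dots> = (\<Sum>b\<in>UNIV. \<Sum>d\<in>UNIV. \<Sum>c\<in>UNIV. ?f b c d)"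
        by (rule sum.cong[OF refl], rule sum.swap)
      also have "\<dots> = (\<Sum>d\<in>UNIV. \<Sum>b\<in>UNIV. \<Sum>c\<in>UNIV. ?f b c d)"
        by (rule sum.swap)
      finally show "(\<Sum>c\<in>UNIV. \<Sum>b\<in>UNIV. \<Sum>d\<in>UNIV. ?f b c d) = (\<Sum>d\<in>UNIV. \<Sum>b\<in>UNIV. \<Sum>c\<in>UNIV. ?f b c d)" .
    qed
    also have "\<dots> = (\<Sum>a\<in>UNIV. \<Sum>d\<in>UNIV. of_int (bmult a d e) * u a
            * (\<Sum>b\<in>UNIV. \<Sum>c\<in>UNIV. of_int (bmult b c d) * v b * w c))"
      by (simp add: sum_distrib_left mult_ac)
    finally show "(\<Sum>d\<in>UNIV. \<Sum>c\<in>UNIV. of_int (bmult d c e)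
            * (\<Sum>a\<in>UNIV. \<Sum>b\<in>UNIV. of_int (bmult a b d) * u a * v b) * w c) = \<dots>" .
  qed
  show "1 * u = u"
  proof (transfer, rule ext)
    fix u :: "'a \<Rightarrow> 'b" and e
    have "(\<Sum>d\<in>UNIV. \<Sum>a\<in>UNIV. of_int (bmult d a e) * of_int (bunit d) * u a)
        = (\<Sum>a\<in>UNIV. of_int (\<Sum>d\<in>UNIV. bunit d * bmult d a e) * u a)"
      by (subst sum.swap) (simp add: sum_distrib_left sum_distrib_right mult_ac)
    then show "(\<Sum>d\<in>UNIV. \<Sum>a\<in>UNIV. of_int (bmult d a e) * of_int (bunit d) * u a) = u e"
      by (simp add: bunit_left del: of_int_sum of_int_mult)
  qed
  show "u * 1 = u"
  proof (transfer, rule ext)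
    fix u :: "'a \<Rightarrow> 'b" and e
    have "(\<Sum>a\<in>UNIV. \<Sum>d\<in>UNIV. of_int (bmult a d e) * u a * of_int (bunit d))
        = (\<Sum>a\<in>UNIV. of_int (\<Sum>d\<in>UNIV. bunit d * bmult a d e) * u a)"
      by (simp add: sum_distrib_left sum_distrib_right mult_ac)
    then show "(\<Sum>a\<in>UNIV. \<Sum>d\<in>UNIV. of_int (bmult a d e) * u a * of_int (bunit d)) = u e"
      by (simp add: bunit_right del: of_int_sum of_int_mult)
  qed
  show "(u + v) * w = u * w + v * w"
    by transfer (simp add: algebra_simps sum.distrib)
  show "u * (v + w) = u * v + u * w"
    by transfer (simp add: algebra_simps sum.distrib)
  show "(0 :: ('a, 'b) alg) \<noteq> 1"
  proof
    assume "(0 :: ('a, 'b) alg) = 1"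
    then have z: "(of_int (bunit d) :: 'b) = 0" for d :: 'a
      by (metis one_alg.rep_eq zero_alg.rep_eq)
    have "(of_int (\<Sum>d\<in>UNIV. bunit d * bmult d a a) :: 'b) = 1" for a :: 'a
      by (simp add: bunit_left del: of_int_sum of_int_mult)
    then show False by (simp add: z)
  qed
qed
end

lift_definition scale :: "'k::comm_ring_1 \<Rightarrow> ('b, 'k) alg \<Rightarrow> ('b, 'k) alg" is "\<lambda>r u c. r * u c" .

lift_definition basis :: "'b \<Rightarrow> ('b, 'k::comm_ring_1) alg" is "\<lambda>b c. of_bool (b = c)" .

text \<open>Linear extension of a map given on the basis.\<close>

definition lin_ext :: "('b::finite \<Rightarrow> ('c, 'k::comm_ring_1) alg) \<Rightarrow> ('b, 'k) alg \<Rightarrow> ('c, 'k) alg" where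
  "lin_ext f u = (\<Sum>b\<in>UNIV. scale (coef u b) (f b))"

text \<open>
  \<open>('b \<times> 'c, 'k) alg\<close> is the tensor product of \<open>('b, 'k) alg\<close> and \<open>('c, 'k) alg\<close>: the pair \<open>(b, c)\<close>
  stands for the basis element \<open>b \<otimes> c\<close>.
\<close>

instantiation prod :: (algebra_basis, algebra_basis) algebra_basis
begin
definition "bmult p q r = bmult (fst p) (fst q) (fst r) * bmult (snd p) (snd q) (snd r)"
definition "bunit p = bunit (fst p) * bunit (snd p)"
instance
proof
  have split: "(\<Sum>d\<in>UNIV. f (fst d) * f' (snd d)) = (\<Sum>d\<in>UNIV. f d) * (\<Sum>d\<in>UNIV. f' d)"
    for f :: "'a \<Rightarrow> int" and f' :: "'b \<Rightarrow> int"
    by (simp add: UNIV_Times_UNIV[symmetric] sum_product sum.cartesian_product split_def del: UNIV_Times_UNIV)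
  fix a b c e :: "'a \<times> 'b"
  show "(\<Sum>d\<in>UNIV. bmult a b d * bmult d c e) = (\<Sum>d\<in>UNIV. bmult b c d * bmult a d e)"
    using split[of "\<lambda>d. bmult (fst a) (fst b) d * bmult d (fst c) (fst e)"
                   "\<lambda>d. bmult (snd a) (snd b) d * bmult d (snd c) (snd e)"]
          split[of "\<lambda>d. bmult (fst b) (fst c) d * bmult (fst a) d (fst e)"
                   "\<lambda>d. bmult (snd b) (snd c) d * bmult (snd a) d (snd e)"]
          bmult_assoc[of "fst a" "fst b" "fst c" "fst e"] bmult_assoc[of "snd a" "snd b" "snd c" "snd e"]
    by (simp add: bmult_prod_def mult_ac)
  show "(\<Sum>d\<in>UNIV. bunit d * bmult d a e) = of_bool (a = e)"
    using split[of "\<lambda>d. bunit d * bmult d (fst a) (fst e)" "\<lambda>d. bunit d * bmult d (snd a) (snd e)"]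
    by (simp add: bmult_prod_def bunit_prod_def bunit_left mult_ac prod_eq_iff)
  show "(\<Sum>d\<in>UNIV. bunit d * bmult a d e) = of_bool (a = e)"
    using split[of "\<lambda>d. bunit d * bmult (fst a) d (fst e)" "\<lambda>d. bunit d * bmult (snd a) d (snd e)"]
    by (simp add: bmult_prod_def bunit_prod_def bunit_right mult_ac prod_eq_iff)
qed
end

lift_definition tensor :: "('b, 'k::comm_ring_1) alg \<Rightarrow> ('c, 'k) alg \<Rightarrow> ('b \<times> 'c, 'k) alg" (infixr \<open>\<otimes>\<close> 75)
  is "\<lambda>u v p. u (fst p) * v (snd p)" .

lemma tensor_mult: "(u \<otimes> v) * (u' \<otimes> v') = (u * u') \<otimes> (v * v')"
  for u u' :: "('b::algebra_basis, 'k::comm_ring_1) alg" and v v' :: "('c::algebra_basis, 'k) alg"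
proof (transfer, rule ext)
  fix u u' :: "'b \<Rightarrow> 'k" and v v' :: "'c \<Rightarrow> 'k" and r :: "'b \<times> 'c"
  have "(\<Sum>p\<in>UNIV. \<Sum>q\<in>UNIV. of_int (bmult p q r) * (u (fst p) * v (snd p)) * (u' (fst q) * v' (snd q)))
      = (\<Sum>a\<in>UNIV. \<Sum>c\<in>UNIV. \<Sum>b\<in>UNIV. \<Sum>d\<in>UNIV. (of_int (bmult a b (fst r)) * u a * u' b)
            * (of_int (bmult c d (snd r)) * v c * v' d))"
    by (simp add: UNIV_Times_UNIV[symmetric] sum.cartesian_product' bmult_prod_def mult_ac
        del: UNIV_Times_UNIV)
  also have "\<dots> = (\<Sum>a\<in>UNIV. \<Sum>b\<in>UNIV. \<Sum>c\<in>UNIV. \<Sum>d\<in>UNIV. (of_int (bmult a b (fst r)) * u a * u' b)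
            * (of_int (bmult c d (snd r)) * v c * v' d))"
    by (rule sum.cong[OF refl], rule sum.swap)
  also have "\<dots> = (\<Sum>a\<in>UNIV. \<Sum>b\<in>UNIV. of_int (bmult a b (fst r)) * u a * u' b)
            * (\<Sum>c\<in>UNIV. \<Sum>d\<in>UNIV. of_int (bmult c d (snd r)) * v c * v' d)"
    by (simp only: sum_distrib_right) (simp only: sum_distrib_left)
  finally show "(\<Sum>p\<in>UNIV. \<Sum>q\<in>UNIV. of_int (bmult p q r) * (u (fst p) * v (snd p)) * (u' (fst q) * v' (snd q)))
      = \<dots>" .
qed

text \<open>\<open>tensor_map f f'\<close> is \<open>f \<otimes> f'\<close>, for linear maps \<open>f\<close> and \<open>f'\<close>.\<close>

definition tensor_map ::
  "(('b::finite, 'k::comm_ring_1) alg \<Rightarrow> ('d, 'k) alg) \<Rightarrow> (('c::finite, 'k) alg \<Rightarrow> ('e, 'k) alg) \<Rightarrow>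
   ('b \<times> 'c, 'k) alg \<Rightarrow> ('d \<times> 'e, 'k) alg" where
  "tensor_map f f' = lin_ext (\<lambda>(b, c). f (basis b) \<otimes> f' (basis c))"

definition flip :: "('b::finite \<times> 'c::finite, 'k::comm_ring_1) alg \<Rightarrow> ('c \<times> 'b, 'k) alg" where
  "flip = lin_ext (\<lambda>(b, c). basis c \<otimes> basis b)"

text \<open>
  Since \<open>\<times>\<close> associates to the right, triple tensor products are of the form
  \<open>U \<otimes> (V \<otimes> W)\<close>; \<open>assoc\<close> is the canonical isomorphism from \<open>(U \<otimes> V) \<otimes> W\<close>.
\<close>

definition assoc ::
  "(('b::finite \<times> 'c::finite) \<times> 'd::finite, 'k::comm_ring_1) alg \<Rightarrow> ('b \<times> 'c \<times> 'd, 'k) alg" where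
  "assoc = lin_ext (\<lambda>((b, c), d). basis b \<otimes> basis c \<otimes> basis d)"

type_synonym ('b, 'k) alg2 = "('b \<times> 'b, 'k) alg"
type_synonym ('b, 'k) alg3 = "('b \<times> 'b \<times> 'b, 'k) alg"

definition leg12 :: "('b::algebra_basis, 'k::comm_ring_1) alg2 \<Rightarrow> ('b, 'k) alg3" where
  "leg12 T = assoc (T \<otimes> 1)"

definition leg23 :: "('b::algebra_basis, 'k::comm_ring_1) alg2 \<Rightarrow> ('b, 'k) alg3" where
  "leg23 T = 1 \<otimes> T"

definition leg13 :: "('b::algebra_basis, 'k::comm_ring_1) alg2 \<Rightarrow> ('b, 'k) alg3" where
  "leg13 = lin_ext (\<lambda>(b, c). basis b \<otimes> 1 \<otimes> basis c)"


section \<open>Quasitriangular structures and infinitesimal R-matrices\<close>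

text \<open>
  The bialgebra is \<open>('b, 'k) alg\<close> with comultiplication \<open>\<Delta>\<close>; the conditions below do not involve
  the counit.
\<close>

type_synonym ('b, 'k) comult = "('b, 'k) alg \<Rightarrow> ('b, 'k) alg2"

definition id_comult :: "('b::algebra_basis, 'k::comm_ring_1) comult \<Rightarrow> ('b, 'k) alg2 \<Rightarrow> ('b, 'k) alg3" where
  "id_comult \<Delta> = tensor_map (\<lambda>u. u) \<Delta>"

definition comult_id :: "('b::algebra_basis, 'k::comm_ring_1) comult \<Rightarrow> ('b, 'k) alg2 \<Rightarrow> ('b, 'k) alg3" where
  "comult_id \<Delta> T = assoc (tensor_map \<Delta> (\<lambda>u. u) T)"

definition is_inverse :: "'r::ring_1 \<Rightarrow> 'r \<Rightarrow> bool" where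
  "is_inverse u v \<longleftrightarrow> u * v = 1 \<and> v * u = 1"

definition quasitriangular ::
  "('b::algebra_basis, 'k::comm_ring_1) comult \<Rightarrow> ('b, 'k) alg2 \<Rightarrow> bool" where
  "quasitriangular \<Delta> R \<longleftrightarrow>
     (\<exists>R'. is_inverse R R') \<and>
     (\<forall>h. R * \<Delta> h = flip (\<Delta> h) * R) \<and>
     id_comult \<Delta> R = leg13 R * leg12 R \<and>
     comult_id \<Delta> R = leg13 R * leg23 R"

definition triangular ::
  "('b::algebra_basis, 'k::comm_ring_1) comult \<Rightarrow> ('b, 'k) alg2 \<Rightarrow> bool" where
  "triangular \<Delta> R \<longleftrightarrow> quasitriangular \<Delta> R \<and> is_inverse R (flip R)"

definition infinitesimal_R_matrix ::
  "('b::algebra_basis, 'k::comm_ring_1) comult \<Rightarrow> ('b, 'k) alg2 \<Rightarrow> ('b, 'k) alg2 \<Rightarrow> bool" where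
  "infinitesimal_R_matrix \<Delta> R \<chi> \<longleftrightarrow>
     quasitriangular \<Delta> R \<and>
     (\<forall>h. \<chi> * \<Delta> h = \<Delta> h * \<chi>) \<and>
     (\<forall>R'. is_inverse R R' \<longrightarrow>
        id_comult \<Delta> \<chi> = leg12 \<chi> + leg12 R' * leg13 \<chi> * leg12 R \<and>
        comult_id \<Delta> \<chi> = leg23 \<chi> + leg23 R' * leg13 \<chi> * leg23 R)"


section \<open>The trivial topological bialgebra\<close>

text \<open>
  The completed tensor powers of \<open>H[[\<hbar>]]\<close> are \<open>(H \<otimes> H)[[\<hbar>]]\<close> and \<open>(H \<otimes> H \<otimes> H)[[\<hbar>]]\<close>, with the
  Cauchy product of formal power series; \<open>\<hbar>\<close> is \<open>fps_X\<close>.  The \<open>\<hbar>\<close>-linear extension of a linear map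
  is its coefficientwise application.
\<close>

definition hmap :: "('u \<Rightarrow> 'v) \<Rightarrow> 'u fps \<Rightarrow> 'v fps" where
  "hmap f F = Abs_fps (\<lambda>m. f (fps_nth F m))"

definition quasitriangular_hbar ::
  "('b::algebra_basis, 'k::comm_ring_1) comult \<Rightarrow> ('b, 'k) alg2 fps \<Rightarrow> bool" where
  "quasitriangular_hbar \<Delta> R \<longleftrightarrow>
     (\<exists>R'. is_inverse R R') \<and>
     (\<forall>h :: ('b, 'k) alg fps. R * hmap \<Delta> h = hmap flip (hmap \<Delta> h) * R) \<and>
     hmap (id_comult \<Delta>) R = hmap leg13 R * hmap leg12 R \<and>
     hmap (comult_id \<Delta>) R = hmap leg13 R * hmap leg23 R"

text \<open>
  \<open>exp (\<hbar>\<chi>)\<close> has \<open>\<chi>\<^sup>m / m!\<close> as coefficient of \<open>\<hbar>\<^sup>m\<close>.  In positive characteristic \<open>1 / m!\<close> is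
  meaningless for large \<open>m\<close> (here it is then \<open>0\<close>); the series is used only for \<open>\<chi>\<close> with
  \<open>\<chi>\<^sup>2 = 0\<close>, where the value of \<open>1 / m!\<close> for \<open>m \<ge> 2\<close> is irrelevant.
\<close>

definition exp_hbar :: "('b::algebra_basis, 'k::field) alg \<Rightarrow> ('b, 'k) alg fps" where
  "exp_hbar \<chi> = Abs_fps (\<lambda>m. scale (1 / of_nat (fact m)) (\<chi> ^ m))"


section \<open>The Hopf algebra with group-likes C2 x C2\<close>

text \<open>
  \<open>Mono i k e\<close> is the monomial \<open>g\<^sup>i h\<^sup>k x\<^sup>e\<close> with exponents in \<open>{0, 1}\<close>.  The relations give
  \<open>(g\<^sup>i h\<^sup>k x\<^sup>e) (g\<^sup>j h\<^sup>l x\<^sup>f) = (-1)\<^bsup>e (j + l)\<^esup> g\<^bsup>i + j\<^esup> h\<^bsup>k + l\<^esup> x\<^bsup>e + f\<^esup>\<close>,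
  which vanishes when \<open>e = f = 1\<close>; see \<open>relations\<close> and \<open>basis_monomials\<close> below.
\<close>

datatype monomial = Mono bool bool bool

lemma UNIV_monomial:
  "UNIV = range (\<lambda>(i, k, e). Mono i k e)"
  by (rule sym, rule surjI[of _ "\<lambda>m. case m of Mono i k e \<Rightarrow> (i, k, e)"])
     (simp split: monomial.split)

instance monomial :: finite
  by standard (subst UNIV_monomial, simp)

fun mono_mult :: "monomial \<Rightarrow> monomial \<Rightarrow> monomial" where
  "mono_mult (Mono i k e) (Mono j l f) = Mono (i \<noteq> j) (k \<noteq> l) (e \<noteq> f)"

fun mono_coef :: "monomial \<Rightarrow> monomial \<Rightarrow> int" where
  "mono_coef (Mono i k e) (Mono j l f) =
     (if e \<and> f then 0 else (-1) ^ (of_bool e * (of_bool j + of_bool l)))"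

instantiation monomial :: algebra_basis
begin
definition "bmult a b c = (if c = mono_mult a b then mono_coef a b else 0)"
definition "bunit c = of_bool (c = Mono False False False)"
instance
proof
  fix a b c e :: monomial
  have 1: "mono_mult (mono_mult a b) c = mono_mult a (mono_mult b c)"
    by (cases a; cases b; cases c) auto
  have 2: "mono_coef a b * mono_coef (mono_mult a b) c = mono_coef b c * mono_coef a (mono_mult b c)"
    by (cases a; cases b; cases c) (auto simp: of_bool_def)
  have "(\<Sum>d\<in>UNIV. bmult a b d * bmult d c e)
      = (\<Sum>d\<in>UNIV. if d = mono_mult a b then mono_coef a b * bmult d c e else 0)"
    by (rule sum.cong) (auto simp: bmult_monomial_def)
  moreover have "(\<Sum>d\<in>UNIV. bmult b c d * bmult a d e)
      = (\<Sum>d\<in>UNIV. if d = mono_mult b c then mono_coef b c * bmult a d e else 0)"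
    by (rule sum.cong) (auto simp: bmult_monomial_def)
  ultimately show "(\<Sum>d\<in>UNIV. bmult a b d * bmult d c e) = (\<Sum>d\<in>UNIV. bmult b c d * bmult a d e)"
    using 1 2 by (simp add: bmult_monomial_def)
  have "(\<Sum>d\<in>UNIV. bunit d * bmult d a e)
      = (\<Sum>d\<in>UNIV. if d = Mono False False False then bmult d a e else 0)"
    by (rule sum.cong) (auto simp: bunit_monomial_def)
  then show "(\<Sum>d\<in>UNIV. bunit d * bmult d a e) = of_bool (a = e)"
    by (cases a) (auto simp: bmult_monomial_def)
  have "(\<Sum>d\<in>UNIV. bunit d * bmult a d e)
      = (\<Sum>d\<in>UNIV. if d = Mono False False False then bmult a d e else 0)"
    by (rule sum.cong) (auto simp: bunit_monomial_def)
  then show "(\<Sum>d\<in>UNIV. bunit d * bmult a d e) = of_bool (a = e)"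
    by (cases a) (auto simp: bmult_monomial_def)
qed
end

definition g0 :: "(monomial, 'k::comm_ring_1) alg" where "g0 = basis (Mono True False False)"
definition h0 :: "(monomial, 'k::comm_ring_1) alg" where "h0 = basis (Mono False True False)"
definition x0 :: "(monomial, 'k::comm_ring_1) alg" where "x0 = basis (Mono False False True)"

text \<open>The algebra map with \<open>g \<mapsto> g \<otimes> g\<close>, \<open>h \<mapsto> h \<otimes> h\<close>, \<open>x \<mapsto> 1 \<otimes> x + x \<otimes> g\<close>.\<close>

definition comult0 :: "(monomial, 'k::comm_ring_1) comult" where
  "comult0 = lin_ext (\<lambda>m. case m of Mono i k e \<Rightarrow>
     (g0 \<otimes> g0) ^ of_bool i * (h0 \<otimes> h0) ^ of_bool k * (1 \<otimes> x0 + x0 \<otimes> g0) ^ of_bool e)"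

lemma basis_mult_mono:
  "(basis a :: (monomial, 'k::comm_ring_1) alg) * basis b = scale (of_int (mono_coef a b)) (basis (mono_mult a b))"
proof (transfer, rule ext)
  fix a b c :: monomial
  have "(\<Sum>a'\<in>UNIV. \<Sum>b'\<in>UNIV. of_int (bmult a' b' c) * of_bool (a = a') * (of_bool (b = b') :: 'k))
      = (\<Sum>a'\<in>UNIV. if a' = a then \<Sum>b'\<in>UNIV. if b' = b then of_int (bmult a b c) else 0 else 0)"
    by (intro sum.cong) (auto intro!: sum.cong sum.neutral)
  then show "(\<Sum>a'\<in>UNIV. \<Sum>b'\<in>UNIV. of_int (bmult a' b' c) * of_bool (a = a') * (of_bool (b = b') :: 'k))
      = of_int (mono_coef a b) * of_bool (mono_mult a b = c)"
    by (auto simp: bmult_monomial_def)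
qed

lemma one_mono: "(1 :: (monomial, 'k::comm_ring_1) alg) = basis (Mono False False False)"
  by transfer (auto simp: bunit_monomial_def fun_eq_iff)

lemma scale_simps [simp]: "scale 1 u = u" "scale 0 u = 0" "scale (-1) u = - u"
  by (transfer; simp)+

lemma scale_0_right [simp]: "scale r (0 :: ('b, 'k::comm_ring_1) alg) = 0"
  by transfer simp

lemma relations:
  "g0 * g0 = (1 :: (monomial, 'k::comm_ring_1) alg)" "h0 * h0 = (1 :: (monomial, 'k) alg)"
  "x0 * x0 = (0 :: (monomial, 'k) alg)" "g0 * h0 = (h0 * g0 :: (monomial, 'k) alg)"
  "g0 * x0 = (- (x0 * g0) :: (monomial, 'k) alg)" "h0 * x0 = (- (x0 * h0) :: (monomial, 'k) alg)"
  by (simp_all add: g0_def h0_def x0_def basis_mult_mono one_mono)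

lemma basis_monomials:
  "basis (Mono i k e) = (g0 ^ of_bool i * h0 ^ of_bool k * x0 ^ of_bool e :: (monomial, 'k::comm_ring_1) alg)"
  by (cases i; cases k; cases e) (simp_all add: g0_def h0_def x0_def basis_mult_mono one_mono)


lemma scale_mult: "scale r u * v = scale r (u * v)" "u * scale r v = scale r (u * v)"
  for u v :: "('b::algebra_basis, 'k::comm_ring_1) alg"
  by (transfer; simp add: sum_distrib_left mult_ac)+

lemma scale_add: "scale r (u + v) = scale r u + scale r v" "scale (r + s) u = scale r u + scale s u"
  by (transfer; simp add: algebra_simps)+

lemma scale_scale: "scale r (scale s u) = scale (r * s) u"
  by transfer (simp add: mult_ac)

lemma scale_sum: "scale r (sum f A) = (\<Sum>a\<in>A. scale r (f a))"
  by (induction A rule: infinite_finite_induct) (simp_all add: scale_add)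

lemma coef_sum: "coef (sum f A) c = (\<Sum>a\<in>A. coef (f a) c)"
  by (induction A rule: infinite_finite_induct) (simp_all add: zero_alg.rep_eq plus_alg.rep_eq)

lemma alg_expand: "u = (\<Sum>b\<in>UNIV. scale (coef u b) (basis b))"
  for u :: "('b::finite, 'k::comm_ring_1) alg"
  by (rule alg_eqI) (simp add: coef_sum scale.rep_eq basis.rep_eq of_bool_def if_distrib cong: if_cong)

lemma lin_ext_add: "lin_ext f (u + v) = lin_ext f u + lin_ext f v"
  by (simp add: lin_ext_def plus_alg.rep_eq scale_add sum.distrib)

lemma lin_ext_scale: "lin_ext f (scale r u) = scale r (lin_ext f u)"
  by (simp add: lin_ext_def scale.rep_eq scale_sum scale_scale)

lemma lin_ext_0: "lin_ext f 0 = 0"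
  using lin_ext_add[of f 0 0] by simp

lemma lin_ext_neg: "lin_ext f (- u) = - lin_ext f u"
  using lin_ext_scale[of f "-1" u] by simp

lemma lin_ext_sum: "lin_ext f (sum g A) = (\<Sum>a\<in>A. lin_ext f (g a))"
  by (induction A rule: infinite_finite_induct) (simp_all add: lin_ext_0 lin_ext_add)

lemma lin_ext_basis: "lin_ext f (basis b) = f b"
proof -
  have "lin_ext f (basis b) = (\<Sum>c\<in>UNIV. if c = b then f b else 0)"
    unfolding lin_ext_def by (rule sum.cong) (auto simp: basis.rep_eq)
  then show ?thesis by simp
qed

lemma tensor_add: "(u + u') \<otimes> v = u \<otimes> v + u' \<otimes> v" "u \<otimes> (v + v') = u \<otimes> v + u \<otimes> v'"
  by (transfer; simp add: fun_eq_iff algebra_simps)+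

lemma tensor_neg: "(- u) \<otimes> v = - (u \<otimes> v)" "u \<otimes> (- v) = - (u \<otimes> v)"
  by (transfer; simp add: fun_eq_iff)+

lemma tensor_0: "0 \<otimes> v = 0" "u \<otimes> 0 = 0"
  by (transfer; simp add: fun_eq_iff)+

lemma tensor_one: "1 \<otimes> 1 = 1"
  by transfer (simp add: fun_eq_iff bunit_prod_def)

lemma comult0_generators: "comult0 g0 = g0 \<otimes> g0" "comult0 h0 = h0 \<otimes> h0" "comult0 x0 = 1 \<otimes> x0 + x0 \<otimes> g0"
    "comult0 1 = 1"
  by (simp_all add: comult0_def g0_def h0_def x0_def one_mono lin_ext_basis)

lemma comult0_mult: "comult0 (u * v) = comult0 u * comult0 v"
  for u v :: "(monomial, 'k::comm_ring_1) alg"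
proof -
  define G :: "(monomial, 'k) alg2" where "G = g0 \<otimes> g0"
  define H :: "(monomial, 'k) alg2" where "H = h0 \<otimes> h0"
  define X :: "(monomial, 'k) alg2" where "X = 1 \<otimes> x0 + x0 \<otimes> g0"
  have r: "G * G = 1" "H * H = 1" "X * X = 0" "H * G = G * H" "X * G = - (G * X)" "X * H = - (H * X)"
    by (simp_all add: G_def H_def X_def algebra_simps tensor_mult relations tensor_neg tensor_0 tensor_one)
  have r': "G * (G * u) = u" "H * (H * u) = u" "X * (X * u) = 0" "H * (G * u) = G * (H * u)"
      "X * (G * u) = - (G * (X * u))" "X * (H * u) = - (H * (X * u))" for u
    using r by (simp_all flip: mult.assoc)
  have B: "comult0 (basis m * basis m') = comult0 (basis m) * comult0 (basis m' :: (monomial, 'k) alg)"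
    for m m'
  proof (cases m; cases m')
    fix i k e j l f assume "m = Mono i k e" "m' = Mono j l f"
    then show ?thesis
      by (cases i; cases k; cases e; cases j; cases l; cases f)
         (simp_all add: basis_mult_mono comult0_def lin_ext_0 lin_ext_neg lin_ext_basis G_def[symmetric]
            H_def[symmetric] X_def[symmetric] r r' mult.assoc)
  qed
  have "comult0 (u * v) = comult0 ((\<Sum>b\<in>UNIV. scale (coef u b) (basis b)) * (\<Sum>b\<in>UNIV. scale (coef v b) (basis b)))"
    using alg_expand[of u] alg_expand[of v] by simp
  also have "\<dots> = comult0 (\<Sum>b\<in>UNIV. scale (coef u b) (basis b)) * comult0 (\<Sum>b\<in>UNIV. scale (coef v b) (basis b))"
    by (simp add: sum_product scale_mult scale_scale B comult0_def lin_ext_sum lin_ext_scale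
        flip: B[unfolded comult0_def])
  finally show ?thesis using alg_expand[of u] alg_expand[of v] by simp
qed


section \<open>The group algebra of an elementary abelian 2-group, and the tensor product\<close>

text \<open>
  \<open>Grp c\<close> is the basis element of the group algebra of \<open>'c\<close> given by the group element \<open>c\<close>; the
  group law of \<open>'c\<close> is written additively.
\<close>

datatype 'c grp = Grp (ungrp: 'c)

instance grp :: (finite) finite
proof
  have "(UNIV :: 'a grp set) = Grp ` UNIV" by (metis grp.collapse surjI)
  then show "finite (UNIV :: 'a grp set)" by (metis finite finite_imageI)
qed

instantiation grp :: ("{finite, ab_group_add}") algebra_basis
begin
definition "bmult a b c = (of_bool (ungrp c = ungrp a + ungrp b) :: int)"
definition "bunit c = (of_bool (ungrp c = 0) :: int)"
instance
proof
  fix a b c e :: "'a grp"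
  have eq: "ungrp d = y \<longleftrightarrow> d = Grp y" for d :: "'a grp" and y by (cases d) auto
  have D: "(\<Sum>d\<in>UNIV. of_bool (d = y) * f d) = f y" for y :: "'a grp" and f :: "'a grp \<Rightarrow> int"
    by (simp add: of_bool_def if_distrib[of "\<lambda>t. t * _"] cong: if_cong)
  show "(\<Sum>d\<in>UNIV. bmult a b d * bmult d c e) = (\<Sum>d\<in>UNIV. bmult b c d * bmult a d e)"
    by (simp add: bmult_grp_def eq D add_ac)
  show "(\<Sum>d\<in>UNIV. bunit d * bmult d a e) = of_bool (a = e)"
    by (cases a; cases e) (auto simp: bmult_grp_def bunit_grp_def eq D)
  show "(\<Sum>d\<in>UNIV. bunit d * bmult a d e) = of_bool (a = e)"
    by (cases a; cases e) (auto simp: bmult_grp_def bunit_grp_def eq D)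
qed
end

definition comult_grp :: "('c::{finite, ab_group_add} grp, 'k::comm_ring_1) comult" where
  "comult_grp = lin_ext (\<lambda>c. basis c \<otimes> basis c)"

text \<open>The comultiplication \<open>(id \<otimes> \<tau> \<otimes> id) (\<Delta> \<otimes> \<Delta>')\<close> of a tensor product of two bialgebras.\<close>

definition tensor_comult ::
  "('b::finite, 'k::comm_ring_1) comult \<Rightarrow> ('c::finite, 'k) comult \<Rightarrow> ('b \<times> 'c, 'k) comult" where
  "tensor_comult \<Delta> \<Delta>' u =
     lin_ext (\<lambda>((b, b'), (c, c')). (basis b \<otimes> basis c) \<otimes> (basis b' \<otimes> basis c')) (tensor_map \<Delta> \<Delta>' u)"

text \<open>
  For an elementary abelian 2-group \<open>'c\<close> of order \<open>2\<^bsup>n - 2\<^esup>\<close> (for \<open>n = 2\<close> the trivial group),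
  \<open>('c Abasis, 'k) alg\<close> with \<open>comult\<close> is the Hopf algebra with coradical the group algebra of
  \<open>C\<^sub>2\<^sup>n\<close>.  Such types exist for every \<open>n \<ge> 2\<close>: the one-element type \<open>1\<close> of numeral types for \<open>n = 2\<close>,
  and \<open>2 ^ 'm\<close> (vectors over the two-element ring) with \<open>CARD('m) = n - 2\<close> for \<open>n > 2\<close>.
\<close>

type_synonym 'c Abasis = "monomial \<times> 'c grp"

definition comult :: "('c::{finite, ab_group_add} Abasis, 'k::comm_ring_1) comult" where
  "comult = tensor_comult comult0 comult_grp"

definition gA :: "('c::{finite, ab_group_add} Abasis, 'k::comm_ring_1) alg" where "gA = g0 \<otimes> 1"
definition hA :: "('c::{finite, ab_group_add} Abasis, 'k::comm_ring_1) alg" where "hA = h0 \<otimes> 1"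
definition xA :: "('c::{finite, ab_group_add} Abasis, 'k::comm_ring_1) alg" where "xA = x0 \<otimes> 1"

definition R_q :: "nat \<Rightarrow> ('c::{finite, ab_group_add} Abasis, 'k::field) alg2" where
  "R_q q = scale (1 / 4) (\<Sum>i=0..1. \<Sum>j=0..1. \<Sum>k=0..1. \<Sum>l=0..1.
     scale ((-1) powi (- int (i * j) - int (k * l)))
       ((gA ^ i * hA ^ k) \<otimes> (gA ^ (j + q * (j + l)) * hA ^ (q * (j + l)))))"

definition R_aq :: "'k \<Rightarrow> nat \<Rightarrow> ('c::{finite, ab_group_add} Abasis, 'k::field) alg2" where
  "R_aq a q = R_q q * (1 \<otimes> 1 + scale a (xA \<otimes> (gA * xA)))"

definition chi :: "'k \<Rightarrow> ('c::{finite, ab_group_add} Abasis, 'k::field) alg2" where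
  "chi \<alpha> = scale \<alpha> (xA \<otimes> (xA * gA))"

end

theory Submission
  imports Defs
begin

text \<open>
  Put \<open>N = x \<otimes> gx\<close> and \<open>E = x \<otimes> g \<otimes> gx\<close>. Then \<open>N\<^sup>2 = 0\<close>, \<open>N\<close> commutes with the image of \<open>\<Delta>\<close>,
  \<open>(id \<otimes> \<Delta>) N = N\<^sub>1\<^sub>2 + E\<close>, \<open>(\<Delta> \<otimes> id) N = N\<^sub>2\<^sub>3 + E\<close>, the products of \<open>E\<close> with \<open>N\<^sub>1\<^sub>2\<close> and \<open>N\<^sub>2\<^sub>3\<close>
  vanish, and \<open>N\<^sub>1\<^sub>3 R\<^sub>1\<^sub>2 = R\<^sub>1\<^sub>2 E\<close>, \<open>N\<^sub>1\<^sub>3 R\<^sub>2\<^sub>3 = R\<^sub>2\<^sub>3 E\<close> for \<open>R = R\<^sub>q\<close>.  These identities survive the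
  replacement of \<open>R\<close> by \<open>R (1 + z N)\<close> with \<open>z\<close> central, which stays quasitriangular: a scalar \<open>z = a\<close> leads from
  \<open>R\<^sub>q\<close> to \<open>R\<^sub>a\<close>, and \<open>z = - \<alpha>\<hbar>\<close> leads from \<open>R\<^sub>a\<close> to \<open>R\<^sub>a exp (\<hbar>\<chi>)\<close>, because \<open>\<chi> = - \<alpha> N\<close>.
  The element \<open>R\<^sub>q\<close> itself is a product of bicharacters \<open>(1 \<otimes> 1 + u \<otimes> 1 + 1 \<otimes> v - u \<otimes> v) / 2\<close> with
  \<open>u, v \<in> {g, h}\<close>, which are easy to commute past \<open>x\<close>.
\<close>

section \<open>Linear maps and algebra homomorphisms\<close>

definition alg_linear :: "(('b, 'k::comm_ring_1) alg \<Rightarrow> ('c, 'k) alg) \<Rightarrow> bool" where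
  "alg_linear f \<longleftrightarrow> (\<forall>u v. f (u + v) = f u + f v) \<and> (\<forall>r u. f (scale r u) = scale r (f u))"

definition alg_hom ::
  "(('b::algebra_basis, 'k::comm_ring_1) alg \<Rightarrow> ('c::algebra_basis, 'k) alg) \<Rightarrow> bool" where
  "alg_hom f \<longleftrightarrow> alg_linear f \<and> f 1 = 1 \<and> (\<forall>u v. f (u * v) = f u * f v)"

lemma alg_linearI:
  assumes "\<And>u v. f (u + v) = f u + f v" "\<And>r u. f (scale r u) = scale r (f u)"
  shows "alg_linear f"
  using assms by (simp add: alg_linear_def)

lemma alg_linearD:
  assumes "alg_linear f"
  shows "f (u + v) = f u + f v" "f (scale r u) = scale r (f u)"
    "f 0 = 0" "f (- u) = - f u" "f (u - v) = f u - f v"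
proof -
  show add: "f (u + v) = f u + f v" for u v
    using assms by (simp add: alg_linear_def)
  show sc: "f (scale r u) = scale r (f u)" for r u
    using assms by (simp add: alg_linear_def)
  show "f 0 = 0" using add[of 0 0] by simp
  show neg: "f (- u) = - f u" for u using sc[of "-1" u] by simp
  show "f (u - v) = f u - f v" using add[of u "- v"] neg[of v] by simp
qed

lemma alg_linear_sum: "alg_linear f \<Longrightarrow> f (sum F A) = (\<Sum>a\<in>A. f (F a))"
  by (induction A rule: infinite_finite_induct) (simp_all add: alg_linearD)

lemma alg_homD:
  assumes "alg_hom f"
  shows "alg_linear f" "f 1 = 1" "f (u * v) = f u * f v"
  using assms by (simp_all add: alg_hom_def)

lemma alg_linear_lin_ext: "alg_linear (lin_ext f)"
  by (simp add: alg_linearI lin_ext_add lin_ext_scale)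

lemma alg_linear_id: "alg_linear (\<lambda>u. u)"
  by (simp add: alg_linearI)

lemma alg_hom_id: "alg_hom (\<lambda>u. u)"
  by (simp add: alg_hom_def alg_linear_id)

lemma alg_linear_comp: "alg_linear f \<Longrightarrow> alg_linear f' \<Longrightarrow> alg_linear (\<lambda>u. f (f' u))"
  by (simp add: alg_linear_def)

lemma alg_hom_comp: "alg_hom f \<Longrightarrow> alg_hom f' \<Longrightarrow> alg_hom (\<lambda>u. f (f' u))"
  by (simp add: alg_hom_def alg_linear_comp)

lemma alg_linear_scale: "alg_linear (scale r)"
  by (simp add: alg_linearI scale_add scale_scale mult.commute)

lemma scale_neg: "scale r (- u) = - scale r u" "scale r (u - v) = scale r u - scale r v"
  by (simp_all add: alg_linearD alg_linear_scale)


section \<open>Maps out of tensor products\<close>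

lemma tensor_scale: "scale r u \<otimes> v = scale r (u \<otimes> v)" "u \<otimes> scale r v = scale r (u \<otimes> v)"
  by (transfer; simp add: fun_eq_iff mult_ac)+

lemma basis_pair: "basis (b, c) = basis b \<otimes> basis c"
  by transfer auto

lemma alg_linear_tensor: "alg_linear (\<lambda>u. u \<otimes> v)" "alg_linear (\<lambda>v. u \<otimes> v)"
  by (simp_all add: alg_linearI tensor_add tensor_scale)

text \<open>Expansion in the finite basis. The scalar in the \<open>basis\<close> case also covers
  the zero element.\<close>

lemma alg_induct [case_names basis add]:
  fixes u :: "('b::finite, 'k::comm_ring_1) alg"
  assumes basis: "\<And>r b. P (scale r (basis b))" and add: "\<And>u v. P u \<Longrightarrow> P v \<Longrightarrow> P (u + v)"
  shows "P u"
proof -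
  have "P (\<Sum>b\<in>A. scale (coef u b) (basis b))" if "finite A" for A
    using that
  proof (induction A rule: finite_induct)
    case empty
    \<comment> \<open>The empty sum is obtained as \<open>0\<close> times an arbitrary basis
      element.\<close>
    show ?case using basis[of 0 undefined] by simp
  qed (simp add: basis add)
  then show ?thesis by (subst alg_expand) simp
qed

text \<open>Scalars are absorbed into the left tensor factor, so every element is a sum of pure
  tensors. Identities additive in one argument may therefore be checked on pure tensors in that
  argument.\<close>

lemma tensor_induct [case_names tensor add]:
  fixes u :: "('b::finite \<times> 'c::finite, 'k::comm_ring_1) alg"
  assumes tensor: "\<And>v w. P (v \<otimes> w)" and add: "\<And>u v. P u \<Longrightarrow> P v \<Longrightarrow> P (u + v)"
  shows "P u"
proof (induction u rule: alg_induct)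
  case (basis r p)
  show ?case
    using tensor[of "scale r (basis (fst p))" "basis (snd p)"]
    by (simp add: tensor_scale flip: basis_pair)
qed (rule add)

text \<open>The universal property of the tensor product. It evaluates maps given by
  \<open>lin_ext\<close> on pairs of basis elements at arbitrary pure tensors.\<close>

lemma lin_ext_tensor:
  assumes "\<And>v. alg_linear (\<lambda>u. B u v)" and "\<And>u. alg_linear (B u)"
  shows "lin_ext (\<lambda>(b, c). B (basis b) (basis c)) (u \<otimes> v) = B u v"
proof -
  have "B u v = B (\<Sum>b\<in>UNIV. scale (coef u b) (basis b)) (\<Sum>c\<in>UNIV. scale (coef v c) (basis c))"
    using alg_expand[of u] alg_expand[of v] by simp
  also have "\<dots> = (\<Sum>b\<in>UNIV. \<Sum>c\<in>UNIV. scale (coef u b * coef v c) (B (basis b) (basis c)))"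
    by (simp add: alg_linear_sum[OF assms(1)] alg_linear_sum[OF assms(2)]
        alg_linearD(2)[OF assms(1)] alg_linearD(2)[OF assms(2)] scale_sum scale_scale mult.commute)
       (rule sum.swap)
  also have "\<dots> = lin_ext (\<lambda>(b, c). B (basis b) (basis c)) (u \<otimes> v)"
    by (simp add: lin_ext_def tensor.rep_eq sum.cartesian_product split_def)
  finally show ?thesis ..
qed

lemma alg_homI_basis:
  assumes "alg_linear f" and "f 1 = 1"
    and "\<And>a b. f (basis a * basis b) = f (basis a) * f (basis b)"
  shows "alg_hom f"
proof -
  have "f (basis a * v) = f (basis a) * f v" for a v
    by (induction v rule: alg_induct)
       (simp_all add: assms(3) distrib_left scale_mult alg_linearD[OF assms(1)])
  then have "f (u * v) = f u * f v" for u v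
    by (induction u rule: alg_induct)
       (simp_all add: distrib_right scale_mult alg_linearD[OF assms(1)])
  then show ?thesis using assms by (simp add: alg_hom_def)
qed

lemma alg_homI_tensor:
  assumes "alg_linear f" and "f (1 \<otimes> 1) = 1"
    and "\<And>u v u' v'. f ((u \<otimes> v) * (u' \<otimes> v')) = f (u \<otimes> v) * f (u' \<otimes> v')"
  shows "alg_hom f"
proof -
  have "f ((u \<otimes> v) * t) = f (u \<otimes> v) * f t" for u v t
    by (induction t rule: tensor_induct)
       (simp_all only: assms(3) distrib_left alg_linearD(1)[OF assms(1)])
  then have "f (s * t) = f s * f t" for s t
    by (induction s rule: tensor_induct) (simp_all add: distrib_right alg_linearD[OF assms(1)])
  then show ?thesis using assms by (simp add: alg_hom_def tensor_one)
qed

section \<open>Tensor products of maps, the flip and the associativity isomorphism\<close>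

lemma tensor_map_tensor:
  assumes "alg_linear f" "alg_linear f'"
  shows "tensor_map f f' (u \<otimes> v) = f u \<otimes> f' v"
  unfolding tensor_map_def
  by (rule lin_ext_tensor) (simp_all add: alg_linearI alg_linearD[OF assms(1)] alg_linearD[OF assms(2)]
      tensor_add tensor_scale)

lemma alg_hom_tensor_map:
  assumes "alg_hom f" "alg_hom f'"
  shows "alg_hom (tensor_map f f')"
proof (rule alg_homI_tensor)
  show "alg_linear (tensor_map f f')"
    by (simp add: tensor_map_def alg_linear_lin_ext)
qed (simp_all add: tensor_map_tensor tensor_mult alg_homD[OF assms(1)] alg_homD[OF assms(2)],
    simp add: tensor_one)

lemma flip_tensor: "flip (u \<otimes> v) = v \<otimes> u"
  unfolding flip_def by (rule lin_ext_tensor) (simp_all add: alg_linear_tensor)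

lemma alg_linear_flip: "alg_linear flip"
  by (simp add: flip_def alg_linear_lin_ext)

lemma alg_hom_flip: "alg_hom flip"
  by (rule alg_homI_tensor) (simp_all add: alg_linear_flip flip_tensor tensor_mult, simp add: tensor_one)

lemma flip_flip: "flip (flip u) = u"
  by (induction u rule: tensor_induct) (simp_all add: flip_tensor alg_linearD[OF alg_linear_flip])

text \<open>An injective relabelling of the basis carries coefficients along. This handles
  \<open>assoc\<close> and \<open>shuffle\<close>, whose nested arguments go beyond the bilinear
  \<open>lin_ext_tensor\<close>.\<close>

lemma coef_lin_ext_basis:
  assumes "inj \<pi>"
  shows "coef (lin_ext (\<lambda>p. basis (\<pi> p)) u) (\<pi> p) = coef u p"
proof -
  have "coef (lin_ext (\<lambda>p. basis (\<pi> p)) u) (\<pi> p) = (\<Sum>p'\<in>UNIV. if p' = p then coef u p else 0)"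
    unfolding lin_ext_def coef_sum
    by (rule sum.cong) (auto simp: scale.rep_eq basis.rep_eq inj_eq[OF assms])
  then show ?thesis by simp
qed

lemma assoc_tensor:
  fixes u :: "('b::finite, 'k::comm_ring_1) alg" and v :: "('c::finite, 'k) alg" and w :: "('d::finite, 'k) alg"
  shows "assoc ((u \<otimes> v) \<otimes> w) = u \<otimes> v \<otimes> w"
proof (rule alg_eqI)
  fix p :: "'b \<times> 'c \<times> 'd"
  let ?\<pi> = "\<lambda>((b, c), d). (b, c, d) :: 'b \<times> 'c \<times> 'd"
  have "inj ?\<pi>" by (auto simp: inj_def)
  from coef_lin_ext_basis[OF this, of "(u \<otimes> v) \<otimes> w" "((fst p, fst (snd p)), snd (snd p))"]
  show "coef (assoc ((u \<otimes> v) \<otimes> w)) p = coef (u \<otimes> v \<otimes> w) p"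
    by (simp add: assoc_def tensor.rep_eq case_prod_unfold mult.assoc flip: basis_pair)
qed

lemma alg_linear_assoc: "alg_linear assoc"
  by (simp add: assoc_def alg_linear_lin_ext)

lemma alg_hom_assoc: "alg_hom assoc"
proof (rule alg_homI_tensor)
  show "assoc (1 \<otimes> 1) = 1"
    by (simp add: assoc_tensor flip: tensor_one)
  \<comment> \<open>The left components are themselves tensors, so they are split one at a time:
    first \<open>u'\<close>, then \<open>u\<close>.\<close>
  have *: "assoc (((a \<otimes> b) \<otimes> v) * (u' \<otimes> v')) = assoc ((a \<otimes> b) \<otimes> v) * assoc (u' \<otimes> v')"
    for a :: "('a, 'd) alg" and b :: "('b, 'd) alg" and v v' :: "('c, 'd) alg" and u'
    by (induction u' rule: tensor_induct)
       (simp_all add: tensor_add distrib_left alg_linearD[OF alg_linear_assoc], simp add: tensor_mult assoc_tensor)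
  show "assoc ((u \<otimes> v) * (u' \<otimes> v')) = assoc (u \<otimes> v) * assoc (u' \<otimes> v')"
    for u u' :: "('a \<times> 'b, 'd) alg" and v v' :: "('c, 'd) alg"
    by (induction u rule: tensor_induct)
       (simp_all add: * tensor_add distrib_right alg_linearD[OF alg_linear_assoc])
qed (rule alg_linear_assoc)

section \<open>Legs and coproducts on the triple tensor product\<close>

lemma leg_tensor:
  "leg12 (u \<otimes> v) = u \<otimes> v \<otimes> 1" "leg13 (u \<otimes> v) = u \<otimes> 1 \<otimes> v" "leg23 (u \<otimes> v) = 1 \<otimes> u \<otimes> v"
proof -
  show "leg13 (u \<otimes> v) = u \<otimes> 1 \<otimes> v"
    unfolding leg13_def by (rule lin_ext_tensor) (simp_all add: alg_linearI tensor_add tensor_scale)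
qed (simp_all add: leg12_def leg23_def assoc_tensor)

lemma alg_hom_leg12: "alg_hom leg12"
proof -
  have "alg_hom (\<lambda>T :: ('a \<times> 'a, 'b) alg. T \<otimes> (1 :: ('a, 'b) alg))"
    by (simp add: alg_hom_def alg_linear_tensor tensor_one tensor_mult)
  then show ?thesis
    unfolding leg12_def[abs_def] by (rule alg_hom_comp[OF alg_hom_assoc])
qed

lemma alg_hom_leg23: "alg_hom leg23"
  by (simp add: leg23_def[abs_def] alg_hom_def alg_linear_tensor tensor_one tensor_mult)

lemma alg_hom_leg13: "alg_hom leg13"
proof (rule alg_homI_tensor)
  show "leg13 (1 \<otimes> 1) = 1"
    by (simp add: leg_tensor) (simp add: tensor_one)
qed (simp add: leg13_def alg_linear_lin_ext, simp add: leg_tensor tensor_mult)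

lemmas alg_hom_leg = alg_hom_leg12 alg_hom_leg13 alg_hom_leg23

lemma id_comult_tensor: "alg_linear \<Delta> \<Longrightarrow> id_comult \<Delta> (u \<otimes> v) = u \<otimes> \<Delta> v"
  by (simp add: id_comult_def tensor_map_tensor alg_linear_id)

lemma comult_id_tensor: "alg_linear \<Delta> \<Longrightarrow> comult_id \<Delta> (u \<otimes> v) = assoc (\<Delta> u \<otimes> v)"
  by (simp add: comult_id_def tensor_map_tensor alg_linear_id)

lemma alg_hom_id_comult: "alg_hom \<Delta> \<Longrightarrow> alg_hom (id_comult \<Delta>)"
  by (simp add: id_comult_def alg_hom_tensor_map alg_hom_id)

lemma alg_hom_comult_id: "alg_hom \<Delta> \<Longrightarrow> alg_hom (comult_id \<Delta>)"
  unfolding comult_id_def[abs_def] by (rule alg_hom_comp[OF alg_hom_assoc alg_hom_tensor_map[OF _ alg_hom_id]])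


section \<open>The comultiplication\<close>

lemma alg_hom_comult0: "alg_hom comult0"
  by (simp add: alg_hom_def comult0_mult comult0_generators) (simp add: comult0_def alg_linear_lin_ext)

lemma basis_mult_grp:
  fixes a b :: "'c::{finite, ab_group_add} grp"
  shows "(basis a :: ('c grp, 'k::comm_ring_1) alg) * basis b = basis (Grp (ungrp a + ungrp b))"
proof (rule alg_eqI)
  fix c
  have "coef ((basis a :: ('c grp, 'k) alg) * basis b) c
      = (\<Sum>a'\<in>UNIV. if a' = a then \<Sum>b'\<in>UNIV. if b' = b then of_int (bmult a b c) else 0 else 0)"
    unfolding times_alg.rep_eq basis.rep_eq by (intro sum.cong) (auto intro!: sum.cong sum.neutral)
  also have "\<dots> = coef (basis (Grp (ungrp a + ungrp b))) c"
    by (cases c) (simp add: basis.rep_eq bmult_grp_def eq_commute)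
  finally show "coef ((basis a :: ('c grp, 'k) alg) * basis b) c = coef (basis (Grp (ungrp a + ungrp b))) c" .
qed

lemma one_grp: "(1 :: ('c::{finite, ab_group_add} grp, 'k::comm_ring_1) alg) = basis (Grp 0)"
proof (rule alg_eqI)
  show "coef (1 :: ('c grp, 'k) alg) b = coef (basis (Grp 0)) b" for b
    by (cases b) (auto simp: one_alg.rep_eq basis.rep_eq bunit_grp_def)
qed

lemma alg_hom_comult_grp: "alg_hom comult_grp"
proof (rule alg_homI_basis)
  show "comult_grp 1 = 1"
    by (simp add: comult_grp_def one_grp lin_ext_basis) (simp add: tensor_one flip: one_grp)
qed (simp_all add: comult_grp_def alg_linear_lin_ext basis_mult_grp lin_ext_basis tensor_mult)

text \<open>The middle interchange inside \<open>tensor_comult\<close>, named so that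
  \<open>comult\<close> becomes a composite of algebra homomorphisms.\<close>

definition shuffle ::
  "(('b::finite \<times> 'b) \<times> ('c::finite \<times> 'c), 'k::comm_ring_1) alg \<Rightarrow> (('b \<times> 'c) \<times> ('b \<times> 'c), 'k) alg" where
  "shuffle = lin_ext (\<lambda>((b, b'), (c, c')). (basis b \<otimes> basis c) \<otimes> (basis b' \<otimes> basis c'))"

lemma shuffle_tensor:
  fixes u u' :: "('b::finite, 'k::comm_ring_1) alg" and v v' :: "('c::finite, 'k) alg"
  shows "shuffle ((u \<otimes> u') \<otimes> (v \<otimes> v')) = (u \<otimes> v) \<otimes> (u' \<otimes> v')"
proof (rule alg_eqI)
  fix p :: "('b \<times> 'c) \<times> ('b \<times> 'c)"
  let ?\<pi> = "\<lambda>((b, b'), (c, c')). ((b, c), (b', c')) :: ('b \<times> 'c) \<times> ('b \<times> 'c)"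
  have "inj ?\<pi>" by (auto simp: inj_def)
  from coef_lin_ext_basis[OF this, of "(u \<otimes> u') \<otimes> (v \<otimes> v')"
      "((fst (fst p), fst (snd p)), (snd (fst p), snd (snd p)))"]
  show "coef (shuffle ((u \<otimes> u') \<otimes> (v \<otimes> v'))) p = coef ((u \<otimes> v) \<otimes> (u' \<otimes> v')) p"
    by (simp add: shuffle_def tensor.rep_eq case_prod_unfold mult_ac flip: basis_pair)
qed

lemma alg_linear_shuffle: "alg_linear shuffle"
  by (simp add: shuffle_def alg_linear_lin_ext)

text \<open>On fully split tensors this is factorwise multiplication. The four inductions split the
  components \<open>v'\<close>, \<open>u'\<close>, \<open>v\<close> and \<open>u\<close> in
  turn.\<close>

lemma alg_hom_shuffle: "alg_hom shuffle"
proof (rule alg_homI_tensor)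
  show "shuffle (1 \<otimes> 1) = 1"
    by (simp add: shuffle_tensor flip: tensor_one)
  have 1: "shuffle (((a \<otimes> b) \<otimes> (c \<otimes> d)) * ((a' \<otimes> b') \<otimes> v')) = shuffle ((a \<otimes> b) \<otimes> (c \<otimes> d)) * shuffle ((a' \<otimes> b') \<otimes> v')"
    for a b a' b' :: "('a, 'c) alg" and c d :: "('b, 'c) alg" and v'
    by (induction v' rule: tensor_induct)
       (simp_all add: tensor_add distrib_left alg_linearD[OF alg_linear_shuffle], simp add: tensor_mult shuffle_tensor)
  have 2: "shuffle (((a \<otimes> b) \<otimes> (c \<otimes> d)) * (u' \<otimes> v')) = shuffle ((a \<otimes> b) \<otimes> (c \<otimes> d)) * shuffle (u' \<otimes> v')"
    for a b :: "('a, 'c) alg" and c d :: "('b, 'c) alg" and u' v'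
    by (induction u' rule: tensor_induct)
       (simp_all add: 1 tensor_add distrib_left alg_linearD[OF alg_linear_shuffle])
  have 3: "shuffle (((a \<otimes> b) \<otimes> v) * (u' \<otimes> v')) = shuffle ((a \<otimes> b) \<otimes> v) * shuffle (u' \<otimes> v')"
    for a b :: "('a, 'c) alg" and v v' :: "('b \<times> 'b, 'c) alg" and u'
    by (induction v rule: tensor_induct)
       (simp_all add: 2 tensor_add distrib_right alg_linearD[OF alg_linear_shuffle])
  show "shuffle ((u \<otimes> v) * (u' \<otimes> v')) = shuffle (u \<otimes> v) * shuffle (u' \<otimes> v')"
    for u u' :: "('a \<times> 'a, 'c) alg" and v v' :: "('b \<times> 'b, 'c) alg"
    by (induction u rule: tensor_induct)
       (simp_all add: 3 tensor_add distrib_right alg_linearD[OF alg_linear_shuffle])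
qed (rule alg_linear_shuffle)

lemma alg_hom_comult: "alg_hom comult"
  unfolding comult_def[abs_def] tensor_comult_def[abs_def] shuffle_def[symmetric]
  by (rule alg_hom_comp[OF alg_hom_shuffle alg_hom_tensor_map[OF alg_hom_comult0 alg_hom_comult_grp]])

lemma comult_tensor: "comult (u \<otimes> v) = shuffle (comult0 u \<otimes> comult_grp v)"
  by (simp add: comult_def tensor_comult_def shuffle_def[symmetric]
      tensor_map_tensor alg_homD[OF alg_hom_comult0] alg_homD[OF alg_hom_comult_grp])

lemma comult_generators:
  "comult gA = gA \<otimes> gA" "comult hA = hA \<otimes> hA" "comult xA = 1 \<otimes> xA + xA \<otimes> gA"
  "comult (1 \<otimes> basis c) = (1 \<otimes> basis c) \<otimes> (1 \<otimes> basis c)"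
proof -
  have *: "comult (u \<otimes> 1) = shuffle (comult0 u \<otimes> (1 \<otimes> 1))" for u
    by (simp add: comult_tensor tensor_one alg_homD[OF alg_hom_comult_grp])
  have s: "shuffle ((u \<otimes> u') \<otimes> 1) = (u \<otimes> 1) \<otimes> (u' \<otimes> 1)" for u u'
    using shuffle_tensor[of u u' 1 1] by (simp add: tensor_one)
  show "comult gA = gA \<otimes> gA" "comult hA = hA \<otimes> hA"
    by (simp_all add: gA_def hA_def * comult0_generators shuffle_tensor)
  show "comult xA = 1 \<otimes> xA + xA \<otimes> gA"
    by (simp add: gA_def xA_def * comult0_generators tensor_add alg_linearD[OF alg_linear_shuffle] s tensor_one)
  show "comult (1 \<otimes> basis c) = (1 \<otimes> basis c) \<otimes> (1 \<otimes> basis c)"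
    by (simp add: comult_tensor comult0_generators comult_grp_def lin_ext_basis)
       (simp add: shuffle_tensor flip: tensor_one)
qed

lemma relations_A:
  "gA * gA = 1" "hA * hA = 1" "xA * xA = 0" "hA * gA = gA * hA" "gA * xA = - (xA * gA)" "hA * xA = - (xA * hA)"
  "gA * (1 \<otimes> v) = (1 \<otimes> v) * gA" "hA * (1 \<otimes> v) = (1 \<otimes> v) * hA" "xA * (1 \<otimes> v) = (1 \<otimes> v) * xA"
  by (simp_all add: gA_def hA_def xA_def tensor_mult relations tensor_neg tensor_0 tensor_one)

text \<open>Each basis element is a monomial in \<open>gA\<close>, \<open>hA\<close>,
  \<open>xA\<close> times a group element of the second factor. Commutation relations with
  \<open>comult\<close> thus need checking only on generators.\<close>

lemma A_induct [case_names g h x grp mult add scale]: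
  fixes u :: "('c::{finite, ab_group_add} Abasis, 'k::comm_ring_1) alg"
  assumes gen: "P gA" "P hA" "P xA" "\<And>c. P (1 \<otimes> basis c)"
    and mult: "\<And>u v. P u \<Longrightarrow> P v \<Longrightarrow> P (u * v)" and add: "\<And>u v. P u \<Longrightarrow> P v \<Longrightarrow> P (u + v)"
    and scale: "\<And>r u. P u \<Longrightarrow> P (scale r u)"
  shows "P u"
proof (induction u rule: alg_induct)
  case (basis r p)
  have 1: "P 1" using mult[OF gen(1) gen(1)] by (simp add: relations_A)
  obtain i k e c where p: "p = (Mono i k e, c)" by (metis monomial.exhaust surj_pair)
  have "(basis p :: (_, 'k) alg) = gA ^ of_bool i * hA ^ of_bool k * xA ^ of_bool e * (1 \<otimes> basis c)"
    by (cases i; cases k; cases e)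
       (simp_all add: p basis_pair basis_monomials gA_def hA_def xA_def tensor_mult)
  moreover have "P (gA ^ of_bool i * hA ^ of_bool k * xA ^ of_bool e * (1 \<otimes> basis c))"
    by (cases i; cases k; cases e) (simp_all add: 1 gen mult)
  ultimately have "P (basis p)" by (simp only:)
  then show ?case by (rule scale)
qed (rule add)


section \<open>Deformation by a nilpotent infinitesimal R-matrix\<close>

text \<open>Moving \<open>1 + z * n\<close> past \<open>s\<close> turns it into
  \<open>1 + z * e\<close>, and the quadratic term of \<open>(1 + z * e) * (1 + z * m)\<close>
  vanishes. With \<open>n\<close>, \<open>m\<close> legs of \<open>N\<close> and \<open>r\<close>,
  \<open>s\<close> legs of \<open>R\<close>, this yields the hexagon identities of the deformed
  element.\<close>

lemma deformed_product:
  fixes z :: "'r::ring_1"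
  assumes "\<And>u. z * u = u * z" and "n * s = s * e" and "e * m = 0"
  shows "r * (1 + z * n) * (s * (1 + z * m)) = r * s * (1 + z * (m + e))"
proof -
  have "n * (s * u) = s * (e * u)" for u
    using assms(2) by (metis mult.assoc)
  moreover have "u * (z * v) = z * (u * v)" for u v
    by (metis assms(1) mult.assoc)
  note this[of r] this[of s] this[of n]
  ultimately show ?thesis
    by (simp add: algebra_simps assms(2,3))
qed

lemma is_inverse_deformed:
  fixes z :: "'r::ring_1"
  assumes "\<And>u. z * u = u * z" and "n * n = 0" and "is_inverse r r'"
  shows "is_inverse (r * (1 + z * n)) ((1 - z * n) * r')"
proof -
  have "u * (z * v) = z * (u * v)" for u v
    by (metis assms(1) mult.assoc)
  note c = this[of r] this[of r'] this[of n]
  have n: "n * (n * u) = 0" for u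
    using assms(2) by (metis mult.assoc mult_zero_left)
  have r: "r * r' = 1" "r' * r = 1" "r' * (r * u) = u" for u
    using assms(3) by (simp_all add: is_inverse_def flip: mult.assoc)
  show ?thesis
    by (simp add: is_inverse_def algebra_simps c n r assms(2))
qed

text \<open>Lets a scalar act as the central ring element \<open>z\<close> of the preceding
  lemmas.\<close>

lemma scale_central:
  "scale c 1 * u = u * scale c (1 :: ('b::algebra_basis, 'k::comm_ring_1) alg)"
  by (simp add: scale_mult)

lemma hmap_nth: "fps_nth (hmap f F) m = f (fps_nth F m)"
  by (simp add: hmap_def)

lemma hmap_deformed:
  assumes "alg_hom f"
  shows "hmap f (fps_const u * (1 + fps_X * fps_const v)) = fps_const (f u) * (1 + fps_X * fps_const (f v))"
  by (rule fps_ext) (simp add: hmap_nth distrib_left alg_homD[OF assms] alg_linearD[OF alg_homD(1)[OF assms]])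

text \<open>The data are abstract so that a scalar deformation and one along the formal parameter
  can follow each other. By \<open>leg13_N\<close>, \<open>E\<close> is the common conjugate of
  \<open>leg13 N\<close> by \<open>leg12 R\<close> and by \<open>leg23 R\<close>.\<close>

locale R_deformation =
  fixes \<Delta> :: "('b::algebra_basis, 'k::comm_ring_1) comult" and R N :: "('b, 'k) alg2" and E :: "('b, 'k) alg3"
  assumes hom: "alg_hom \<Delta>"
    and quasi: "quasitriangular \<Delta> R"
    and nilpotent: "N * N = 0"
    and comm: "N * \<Delta> u = \<Delta> u * N"
    and E_leg: "E * leg12 N = 0" "leg12 N * E = 0" "E * leg23 N = 0" "leg23 N * E = 0"
    and id_comult_N: "id_comult \<Delta> N = leg12 N + E"
    and comult_id_N: "comult_id \<Delta> N = leg23 N + E"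
    and leg13_N: "leg13 N * leg12 R = leg12 R * E" "leg13 N * leg23 R = leg23 R * E"
begin

text \<open>Each condition is homogeneous in the pair \<open>N\<close>, \<open>E\<close>.\<close>

lemma scale: "R_deformation \<Delta> R (scale c N) (scale c E)"
  by unfold_locales
     (simp_all add: hom quasi nilpotent comm E_leg id_comult_N comult_id_N leg13_N scale_mult scale_add
       alg_linearD[OF alg_homD(1)[OF alg_hom_leg12]] alg_linearD[OF alg_homD(1)[OF alg_hom_leg13]]
       alg_linearD[OF alg_homD(1)[OF alg_hom_leg23]]
       alg_linearD[OF alg_homD(1)[OF alg_hom_id_comult[OF hom]]]
       alg_linearD[OF alg_homD(1)[OF alg_hom_comult_id[OF hom]]])

lemma deform: "R_deformation \<Delta> (R * (1 + scale c N)) N E"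
proof -
  \<comment> \<open>Writing the scalar as the central factor \<open>scale c 1\<close> brings each
    leg and coproduct into the shape of \<open>deformed_product\<close>.\<close>
  have f: "f (R * (1 + scale c N)) = f R * (1 + scale c 1 * f N)" if "alg_hom f"
    for f :: "('b, 'k) alg2 \<Rightarrow> ('b, 'k) alg3"
    by (simp add: alg_homD[OF that] alg_linearD[OF alg_homD(1)[OF that]] scale_mult)
  note f = f[OF alg_hom_leg12] f[OF alg_hom_leg13] f[OF alg_hom_leg23]
    f[OF alg_hom_id_comult[OF hom]] f[OF alg_hom_comult_id[OF hom]]
  have "quasitriangular \<Delta> (R * (1 + scale c N))"
    unfolding quasitriangular_def
  proof (intro conjI allI)
    obtain R' where "is_inverse R R'"
      using quasi by (auto simp: quasitriangular_def)
    then show "\<exists>R'. is_inverse (R * (1 + scale c N)) R'"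
      using is_inverse_deformed[OF scale_central nilpotent, of R R' c] by (auto simp: scale_mult)
    show "R * (1 + scale c N) * \<Delta> h = flip (\<Delta> h) * (R * (1 + scale c N))" for h
    proof -
      have "(1 + scale c N) * \<Delta> h = \<Delta> h * (1 + scale c N)"
        by (simp add: algebra_simps scale_mult comm)
      then have "R * (1 + scale c N) * \<Delta> h = R * \<Delta> h * (1 + scale c N)"
        by (simp only: mult.assoc)
      also have "R * \<Delta> h = flip (\<Delta> h) * R"
        using quasi by (simp add: quasitriangular_def)
      finally show ?thesis by (simp only: mult.assoc)
    qed
    show "id_comult \<Delta> (R * (1 + scale c N)) = leg13 (R * (1 + scale c N)) * leg12 (R * (1 + scale c N))"
      using quasi
      by (simp add: f id_comult_N quasitriangular_def
          deformed_product[OF scale_central leg13_N(1) E_leg(1)])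
    show "comult_id \<Delta> (R * (1 + scale c N)) = leg13 (R * (1 + scale c N)) * leg23 (R * (1 + scale c N))"
      using quasi
      by (simp add: f comult_id_N quasitriangular_def
          deformed_product[OF scale_central leg13_N(2) E_leg(3)])
  qed
  moreover have "leg13 N * (leg12 R * u) = leg12 R * (E * u)" "leg13 N * (leg23 R * u) = leg23 R * (E * u)" for u
    by (simp_all add: leg13_N flip: mult.assoc)
  \<comment> \<open>The correction terms contain \<open>E * leg12 N\<close> on the left and
    \<open>leg12 N * E\<close> on the right, both zero; likewise for \<open>leg23\<close>.\<close>
  then have "leg13 N * leg12 (R * (1 + scale c N)) = leg12 (R * (1 + scale c N)) * E"
    "leg13 N * leg23 (R * (1 + scale c N)) = leg23 (R * (1 + scale c N)) * E"
    unfolding f by (simp_all add: leg13_N E_leg scale_mult distrib_left distrib_right mult.assoc)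
  ultimately show ?thesis
    by unfold_locales (simp_all add: hom nilpotent comm E_leg id_comult_N comult_id_N)
qed

lemma infinitesimal: "infinitesimal_R_matrix \<Delta> R N"
  unfolding infinitesimal_R_matrix_def
proof (intro conjI allI impI quasi comm)
  fix R' assume "is_inverse R R'"
  then have R': "R' * R = 1" by (simp add: is_inverse_def)
  have *: "f R' * f R = 1" if "alg_hom f" for f :: "('b, 'k) alg2 \<Rightarrow> ('b, 'k) alg3"
    using R' alg_homD[OF that] by metis
  \<comment> \<open>Moving \<open>leg13 N\<close> past \<open>leg12 R\<close> leaves
    \<open>leg12 R' * leg12 R * E\<close>, which is \<open>E\<close>.\<close>
  show "id_comult \<Delta> N = leg12 N + leg12 R' * leg13 N * leg12 R"
    using *[OF alg_hom_leg12] by (simp add: id_comult_N mult.assoc leg13_N) (simp flip: mult.assoc)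
  show "comult_id \<Delta> N = leg23 N + leg23 R' * leg13 N * leg23 R"
    using *[OF alg_hom_leg23] by (simp add: comult_id_N mult.assoc leg13_N) (simp flip: mult.assoc)
qed

text \<open>The argument of \<open>deform\<close> with the central element \<open>fps_X\<close> as
  parameter; the identities for \<open>R\<close>, \<open>N\<close>, \<open>E\<close> are lifted to
  constant series.\<close>

lemma quasitriangular_hbar: "quasitriangular_hbar \<Delta> (fps_const R * (1 + fps_X * fps_const N))"
  unfolding quasitriangular_hbar_def
proof (intro conjI allI)
  obtain R' where "is_inverse R R'"
    using quasi by (auto simp: quasitriangular_def)
  then have "is_inverse (fps_const R) (fps_const R')"
    by (simp add: is_inverse_def)
  then show "\<exists>R'. is_inverse (fps_const R * (1 + fps_X * fps_const N)) R'"
    using is_inverse_deformed[OF fps_mult_fps_X_commute, of "fps_const N"] nilpotent by auto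
  show "fps_const R * (1 + fps_X * fps_const N) * hmap \<Delta> h = hmap flip (hmap \<Delta> h) * (fps_const R * (1 + fps_X * fps_const N))"
    for h
  proof -
    have "fps_const N * hmap \<Delta> h = hmap \<Delta> h * fps_const N"
      by (rule fps_ext) (simp add: hmap_nth comm)
    moreover have "fps_X * (fps_const N * F) = fps_const N * (fps_X * F)" "hmap \<Delta> h * (fps_X * F) = fps_X * (hmap \<Delta> h * F)" for F
      by (metis fps_mult_fps_X_commute mult.assoc)+
    ultimately have "(1 + fps_X * fps_const N) * hmap \<Delta> h = hmap \<Delta> h * (1 + fps_X * fps_const N)"
      by (simp add: distrib_left distrib_right mult.assoc)
    then have "fps_const R * (1 + fps_X * fps_const N) * hmap \<Delta> h = fps_const R * hmap \<Delta> h * (1 + fps_X * fps_const N)"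
      by (simp only: mult.assoc)
    also have "fps_const R * hmap \<Delta> h = hmap flip (hmap \<Delta> h) * fps_const R"
      using quasi by (intro fps_ext) (simp add: hmap_nth quasitriangular_def)
    finally show ?thesis by (simp only: mult.assoc)
  qed
  have c: "fps_const (leg13 N) * fps_const (leg12 R) = fps_const (leg12 R) * fps_const E"
     "fps_const (leg13 N) * fps_const (leg23 R) = fps_const (leg23 R) * fps_const E"
     "fps_const E * fps_const (leg12 N) = 0" "fps_const E * fps_const (leg23 N) = 0"
    by (simp_all add: leg13_N E_leg)
  show "hmap (id_comult \<Delta>) (fps_const R * (1 + fps_X * fps_const N))
      = hmap leg13 (fps_const R * (1 + fps_X * fps_const N)) * hmap leg12 (fps_const R * (1 + fps_X * fps_const N))"
    using quasi deformed_product[OF fps_mult_fps_X_commute c(1,3), of "fps_const (leg13 R)"]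
    by (simp add: hmap_deformed alg_hom_leg alg_hom_id_comult hom id_comult_N quasitriangular_def)
  show "hmap (comult_id \<Delta>) (fps_const R * (1 + fps_X * fps_const N))
      = hmap leg13 (fps_const R * (1 + fps_X * fps_const N)) * hmap leg23 (fps_const R * (1 + fps_X * fps_const N))"
    using quasi deformed_product[OF fps_mult_fps_X_commute c(2,4), of "fps_const (leg13 R)"]
    by (simp add: hmap_deformed alg_hom_leg alg_hom_comult_id hom comult_id_N quasitriangular_def)
qed

end

lemma exp_hbar_nilpotent:
  fixes \<chi> :: "('b::algebra_basis, 'k::field) alg"
  assumes "\<chi> * \<chi> = 0"
  shows "exp_hbar \<chi> = 1 + fps_X * fps_const \<chi>"
proof (rule fps_ext)
  fix m
  have "\<chi> ^ Suc (Suc m) = 0" for m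
    using assms by (simp flip: mult.assoc)
  then show "fps_nth (exp_hbar \<chi>) m = fps_nth (1 + fps_X * fps_const \<chi>) m"
    \<comment> \<open>The degrees 0, 1 and at least 2 are separated; in the last the power of
      \<open>\<chi>\<close> is zero, whatever value the reciprocal factorial takes.\<close>
    by (cases m; cases "m - 1") (auto simp: exp_hbar_def)
qed


section \<open>The R-matrices as products of exchange elements\<close>

text \<open>
  For commuting involutions \<open>u\<close> and \<open>v\<close>, \<open>exchange u v\<close> is the bicharacter acting by \<open>(-1)\<^bsup>ij\<^esup>\<close> on the tensor
  product of the \<open>(-1)\<^sup>i\<close>-eigenspace of \<open>u\<close> and the \<open>(-1)\<^sup>j\<close>-eigenspace of \<open>v\<close>.
\<close>

definition exchange :: "('b::algebra_basis, 'k::field) alg \<Rightarrow> ('b, 'k) alg \<Rightarrow> ('b, 'k) alg2" where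
  "exchange u v = scale (1 / 2) (1 \<otimes> 1 + u \<otimes> 1 + 1 \<otimes> v - u \<otimes> v)"

text \<open>Separated from \<open>quasitriangular\<close> because these two identities can be
  checked on each exchange factor of \<open>R_q\<close> and then multiplied.\<close>

definition hexagons :: "('b::algebra_basis, 'k::comm_ring_1) comult \<Rightarrow> ('b, 'k) alg2 \<Rightarrow> bool" where
  "hexagons \<Delta> M \<longleftrightarrow> id_comult \<Delta> M = leg13 M * leg12 M \<and> comult_id \<Delta> M = leg13 M * leg23 M"

lemma scale_2: "scale 2 u = u + u"
  using scale_add(2)[of 1 1 u] by simp

lemma four_nonzero:
  assumes "(2 :: 'k::field) \<noteq> 0"
  shows "(4 :: 'k) \<noteq> 0"
proof -
  have "(4 :: 'k) = 2 * 2" by simp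
  then show ?thesis using assms by (metis no_zero_divisors)
qed

lemma exchange_square:
  assumes "(2 :: 'k::field) \<noteq> 0" and "u * u = 1" "v * v = 1"
  shows "exchange u v * exchange u v = (1 :: ('b::algebra_basis, 'k) alg2)"
proof -
  have "(1 \<otimes> 1 + u \<otimes> 1 + 1 \<otimes> v - u \<otimes> v) * (1 \<otimes> 1 + u \<otimes> 1 + 1 \<otimes> v - u \<otimes> v) = scale 2 (scale 2 (1 \<otimes> 1))"
    by (simp add: algebra_simps tensor_mult assms scale_2)
  then show ?thesis
    using four_nonzero[OF assms(1)] by (simp add: exchange_def scale_mult scale_scale tensor_one)
qed

lemma exchange_commute:
  assumes "u * u' = u' * u" "v * v' = v' * v"
  shows "exchange u v * exchange u' v' = exchange u' v' * exchange u v"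
  by (simp add: exchange_def scale_mult scale_add(1) scale_neg scale_scale algebra_simps tensor_mult assms)

lemma flip_exchange: "flip (exchange u v) = exchange v u"
  by (simp add: exchange_def alg_linearD[OF alg_linear_flip] flip_tensor algebra_simps)

lemma exchange_left:
  assumes "u * w = w * u"
  shows "exchange u v * (w \<otimes> 1) = (w \<otimes> 1) * exchange u v"
  by (simp add: exchange_def scale_mult scale_add(1) scale_neg scale_scale algebra_simps tensor_mult assms)

lemma exchange_right:
  assumes "v * w = w * v"
  shows "exchange u v * (1 \<otimes> w) = (1 \<otimes> w) * exchange u v"
  by (simp add: exchange_def scale_mult scale_add(1) scale_neg scale_scale algebra_simps tensor_mult assms)

text \<open>Left multiplication by \<open>w\<close> swaps the eigenspaces of \<open>u\<close>, which
  changes the bicharacter by the sign with which \<open>v\<close> acts.\<close>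

lemma exchange_anti_left:
  assumes "u * w = - (w * u)" "v * v = 1"
  shows "exchange u v * (w \<otimes> 1) = (w \<otimes> v) * exchange u v"
  by (simp add: exchange_def scale_mult scale_add(1) scale_neg scale_scale algebra_simps tensor_mult tensor_neg assms)

text \<open>Bimultiplicativity: \<open>(-1)^(i(j+k)) = (-1)^(ij) (-1)^(ik)\<close>, and similarly in
  the first argument. As \<open>u\<close> and \<open>v\<close> are group-like, the coproduct adds
  the eigenvalue exponents.\<close>

lemma hexagons_exchange:
  assumes "(2 :: 'k::field) \<noteq> 0" and "alg_hom (\<Delta> :: ('b::algebra_basis, 'k) comult)"
    and "\<Delta> u = u \<otimes> u" "\<Delta> v = v \<otimes> v" "u * u = 1" "v * v = 1"
  shows "hexagons \<Delta> (exchange u v)"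
proof -
  have lin: "alg_linear \<Delta>" by (rule alg_homD(1)[OF assms(2)])
  have 1: "\<Delta> 1 = 1 \<otimes> 1"
    using alg_homD(2)[OF assms(2)] by (simp add: tensor_one)
  note legs = alg_linearD[OF alg_homD(1)[OF alg_hom_leg12]] alg_linearD[OF alg_homD(1)[OF alg_hom_leg13]]
    alg_linearD[OF alg_homD(1)[OF alg_hom_leg23]] alg_linearD[OF alg_homD(1)[OF alg_hom_id_comult[OF assms(2)]]]
    alg_linearD[OF alg_homD(1)[OF alg_hom_comult_id[OF assms(2)]]]
    leg_tensor id_comult_tensor[OF lin] comult_id_tensor[OF lin] assoc_tensor
  have "(1 \<otimes> 1 \<otimes> 1 + u \<otimes> 1 \<otimes> 1 + 1 \<otimes> 1 \<otimes> v - u \<otimes> 1 \<otimes> v) * (1 \<otimes> 1 \<otimes> 1 + u \<otimes> 1 \<otimes> 1 + 1 \<otimes> v \<otimes> 1 - u \<otimes> v \<otimes> 1)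
      = scale 2 (1 \<otimes> 1 \<otimes> 1 + u \<otimes> 1 \<otimes> 1 + 1 \<otimes> v \<otimes> v - u \<otimes> v \<otimes> v)"
    by (simp add: algebra_simps tensor_mult assms scale_2)
  moreover have "(1 \<otimes> 1 \<otimes> 1 + u \<otimes> 1 \<otimes> 1 + 1 \<otimes> 1 \<otimes> v - u \<otimes> 1 \<otimes> v) * (1 \<otimes> 1 \<otimes> 1 + 1 \<otimes> u \<otimes> 1 + 1 \<otimes> 1 \<otimes> v - 1 \<otimes> u \<otimes> v)
      = scale 2 (1 \<otimes> 1 \<otimes> 1 + u \<otimes> u \<otimes> 1 + 1 \<otimes> 1 \<otimes> v - u \<otimes> u \<otimes> v)"
    by (simp add: algebra_simps tensor_mult assms scale_2)
  moreover have "scale (1 / 2) (scale (1 / 2) (scale 2 t)) = scale (1 / 2) t" for t :: "('b, 'k) alg3"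
    using assms(1) by (simp add: scale_scale)
  ultimately show ?thesis
    by (simp add: hexagons_def exchange_def legs 1 assms(3,4) scale_mult)
qed

text \<open>Regrouping the legs of \<open>M * M'\<close> requires moving \<open>leg12 M\<close> and
  \<open>leg23 M\<close> past \<open>leg13 M'\<close>.\<close>

lemma hexagons_mult:
  assumes "alg_hom \<Delta>" "hexagons \<Delta> M" "hexagons \<Delta> M'"
    and "leg12 M * leg13 M' = leg13 M' * leg12 M" "leg23 M * leg13 M' = leg13 M' * leg23 M"
  shows "hexagons \<Delta> (M * M')"
proof -
  have "leg12 M * (leg13 M' * t) = leg13 M' * (leg12 M * t)"
    "leg23 M * (leg13 M' * t) = leg13 M' * (leg23 M * t)" for t
    by (simp_all add: assms(4,5) flip: mult.assoc)
  then show ?thesis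
    using assms(2,3)
    by (simp add: hexagons_def mult.assoc alg_homD[OF alg_hom_leg12] alg_homD[OF alg_hom_leg13]
        alg_homD[OF alg_hom_leg23] alg_homD[OF alg_hom_id_comult[OF assms(1)]]
        alg_homD[OF alg_hom_comult_id[OF assms(1)]])
qed

lemma exchange_leg_commute:
  assumes "u * u' = u' * u" "v * u' = u' * v" "v * v' = v' * v"
  shows "leg12 (exchange u v) * leg13 (exchange u' v') = leg13 (exchange u' v') * leg12 (exchange u v)"
    "leg23 (exchange u v) * leg13 (exchange u' v') = leg13 (exchange u' v') * leg23 (exchange u v)"
  by (simp_all add: exchange_def alg_linearD[OF alg_homD(1)[OF alg_hom_leg12]]
      alg_linearD[OF alg_homD(1)[OF alg_hom_leg13]] alg_linearD[OF alg_homD(1)[OF alg_hom_leg23]]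
      leg_tensor scale_mult scale_add(1) scale_neg scale_scale algebra_simps tensor_mult assms)

lemma leg_intertwine:
  assumes "M * (a \<otimes> b) = (c \<otimes> d) * M"
  shows "leg12 M * (a \<otimes> b \<otimes> w) = (c \<otimes> d \<otimes> w) * leg12 M"
    "leg23 M * (w \<otimes> a \<otimes> b) = (w \<otimes> c \<otimes> d) * leg23 M"
proof -
  \<comment> \<open>\<open>leg12 M\<close> is trivial in the third factor, where \<open>w\<close>
    sits.\<close>
  have w: "leg12 M * (1 \<otimes> 1 \<otimes> w) = (1 \<otimes> 1 \<otimes> w) * leg12 M"
    by (induction M rule: tensor_induct)
       (simp_all add: leg_tensor tensor_mult distrib_left distrib_right alg_linearD[OF alg_homD(1)[OF alg_hom_leg12]])
  have "leg12 M * (a \<otimes> b \<otimes> w) = leg12 (M * (a \<otimes> b)) * (1 \<otimes> 1 \<otimes> w)"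
    by (simp add: alg_homD(3)[OF alg_hom_leg12] leg_tensor mult.assoc tensor_mult)
  also have "\<dots> = leg12 (c \<otimes> d) * (leg12 M * (1 \<otimes> 1 \<otimes> w))"
    by (simp only: assms alg_homD(3)[OF alg_hom_leg12] mult.assoc)
  also have "\<dots> = (leg12 (c \<otimes> d) * (1 \<otimes> 1 \<otimes> w)) * leg12 M"
    by (simp only: w mult.assoc)
  also have "leg12 (c \<otimes> d) * (1 \<otimes> 1 \<otimes> w) = c \<otimes> d \<otimes> w"
    by (simp add: leg_tensor tensor_mult)
  finally show "leg12 M * (a \<otimes> b \<otimes> w) = (c \<otimes> d \<otimes> w) * leg12 M" .
  show "leg23 M * (w \<otimes> a \<otimes> b) = (w \<otimes> c \<otimes> d) * leg23 M"
    by (simp add: leg23_def tensor_mult assms)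
qed

text \<open>For \<open>q = 0\<close>, summing \<open>(-1)^(kl)\<close> over \<open>l\<close> kills
  \<open>k = 1\<close> and doubles \<open>k = 0\<close>. For \<open>q = 1\<close> the second factor
  is \<open>g^l h^(j+l)\<close>, so the sum splits into the bicharacters of \<open>(g, h)\<close>
  and \<open>(h, gh)\<close>; the latter is the product of those of \<open>(h, g)\<close> and
  \<open>(h, h)\<close>.\<close>

lemma R_q_exchange:
  assumes "(2 :: 'k::field) \<noteq> 0"
  shows "R_q 0 = (exchange gA gA :: ('c::{finite, ab_group_add} Abasis, 'k) alg2)"
    "R_q 1 = (exchange gA hA * (exchange hA gA * exchange hA hA) :: ('c Abasis, 'k) alg2)"
proof -
  let ?g = "gA :: ('c Abasis, 'k) alg" and ?h = "hA :: ('c Abasis, 'k) alg"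
  have I: "{0..1} = {0, 1 :: nat}" by auto
  have s: "(-1) powi (-1) = (-1 :: 'k)" "(-1) powi (-2) = (1 :: 'k)"
    by (simp_all add: power_int_minus)
  have r: "?g * (?g * u) = u" "?h * (?h * u) = u" "?h * (?g * u) = ?g * (?h * u)" for u
    by (simp_all add: relations_A flip: mult.assoc)
  let ?S = "\<lambda>q. \<Sum>i=0..1. \<Sum>j=0..1. \<Sum>k=0..1. \<Sum>l=0..1.
     scale ((-1) powi (- int (i * j) - int (k * l)))
       ((?g ^ i * ?h ^ k) \<otimes> (?g ^ (j + q * (j + l)) * ?h ^ (q * (j + l))))"
  have S0: "?S 0 = scale 2 (1 \<otimes> 1 + ?g \<otimes> 1 + 1 \<otimes> ?g - ?g \<otimes> ?g)"
    by (simp add: I s scale_2 algebra_simps)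
  have half: "1 / 4 * 2 = 1 / (2 :: 'k)"
    using assms four_nonzero[OF assms] by (simp add: field_simps)
  show "R_q 0 = exchange ?g ?g"
    by (simp only: R_q_def exchange_def S0 scale_scale half)
  have "(1 \<otimes> 1 + ?g \<otimes> 1 + 1 \<otimes> ?h - ?g \<otimes> ?h)
      * ((1 \<otimes> 1 + ?h \<otimes> 1 + 1 \<otimes> ?g - ?h \<otimes> ?g) * (1 \<otimes> 1 + ?h \<otimes> 1 + 1 \<otimes> ?h - ?h \<otimes> ?h)) = scale 2 (?S 1)"
    by (simp add: I s scale_2 algebra_simps tensor_mult relations_A r power2_eq_square numeral_3_eq_3)
  moreover have "?S 1 = scale (1 / 2) (scale 2 (?S 1))"
    using assms by (simp only: scale_scale) simp
  ultimately show "R_q 1 = exchange ?g ?h * (exchange ?h ?g * exchange ?h ?h)"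
    using assms by (simp add: R_q_def exchange_def scale_scale scale_mult)
qed

lemma square_mult:
  fixes r s :: "'r::monoid_mult"
  assumes "r * r = 1" "s * s = 1" "r * s = s * r"
  shows "(r * s) * (r * s) = 1"
proof -
  have "(r * s) * (r * s) = r * (s * r) * s"
    by (simp only: mult.assoc)
  also have "\<dots> = r * (r * s) * s"
    by (simp only: assms(3))
  also have "\<dots> = (r * r) * (s * s)"
    by (simp only: mult.assoc)
  finally show ?thesis by (simp add: assms)
qed

lemma intertwine_left_mult:
  assumes "M * (u \<otimes> 1) = (u \<otimes> v) * M" "M' * (u \<otimes> 1) = (u \<otimes> v') * M'" "M * (1 \<otimes> v') = (1 \<otimes> v') * M"
  shows "M * M' * (u \<otimes> 1) = (u \<otimes> (v' * v)) * (M * M')"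
proof -
  have split: "u \<otimes> v' = (1 \<otimes> v') * (u \<otimes> 1)"
    by (simp add: tensor_mult)
  have "M * M' * (u \<otimes> 1) = (M * (1 \<otimes> v')) * (u \<otimes> 1) * M'"
    by (simp only: assms(2) split mult.assoc)
  also have "\<dots> = (1 \<otimes> v') * (M * (u \<otimes> 1)) * M'"
    by (simp only: assms(3) mult.assoc)
  also have "\<dots> = ((1 \<otimes> v') * (u \<otimes> v)) * (M * M')"
    by (simp only: assms(1) mult.assoc)
  finally show ?thesis by (simp add: tensor_mult)
qed

lemma R_q_cases:
  assumes "(2 :: 'k::field) \<noteq> 0" and "q \<in> {0, 1}"
    and "P (exchange gA gA)" and "P (exchange gA hA * (exchange hA gA * exchange hA hA))"
  shows "P (R_q q :: ('c::{finite, ab_group_add} Abasis, 'k) alg2)"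
  using assms by (auto simp only: R_q_exchange[OF assms(1)] insert_iff empty_iff)

section \<open>Commutation rules and quasitriangularity of \<open>R_q\<close>\<close>

context
  fixes q :: nat and M :: "('c::{finite, ab_group_add} Abasis, 'k::field) alg2"
  assumes two: "(2 :: 'k) \<noteq> 0" and q: "q \<in> {0, 1}"
  defines "M \<equiv> R_q q"
begin

lemma hexagons_R_q: "hexagons comult M"
proof -
  have 1: "hexagons comult (exchange u v :: ('c Abasis, 'k) alg2)" if "u \<in> {gA, hA}" "v \<in> {gA, hA}" for u v
    using that by (intro hexagons_exchange[OF two alg_hom_comult]) (auto simp: comult_generators relations_A)
  have leg: "leg12 (exchange u v) * leg13 (exchange u' v') = leg13 (exchange u' v') * leg12 (exchange u v)"
    "leg23 (exchange u v) * leg13 (exchange u' v') = leg13 (exchange u' v') * leg23 (exchange u v)"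
    if "{u, v, u', v'} \<subseteq> {gA, hA}" for u v u' v' :: "('c Abasis, 'k) alg"
    using that by (intro exchange_leg_commute; auto simp: relations_A)+
  show ?thesis
    unfolding M_def
  proof (rule R_q_cases[OF two q])
    show "hexagons comult (exchange gA hA * (exchange hA gA * exchange hA hA) :: ('c Abasis, 'k) alg2)"
      by (intro hexagons_mult alg_hom_comult 1)
         (simp_all add: leg alg_homD(3)[OF alg_hom_leg13] flip: mult.assoc, simp_all add: leg mult.assoc)
  qed (simp add: 1)
qed

lemma exchange_A_commute:
  "exchange u v * exchange u' v' = exchange u' v' * (exchange u v :: ('c Abasis, 'k) alg2)"
  if "{u, v, u', v'} \<subseteq> {gA, hA}"
  using that by (intro exchange_commute) (auto simp: relations_A)

lemma R_q_square: "M * M = 1"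
  unfolding M_def
proof (rule R_q_cases[OF two q])
  have sq: "exchange u v * exchange u v = (1 :: ('c Abasis, 'k) alg2)" if "{u, v} \<subseteq> {gA, hA}" for u v
    using that by (intro exchange_square two) (auto simp: relations_A)
  then show "exchange gA gA * exchange gA gA = (1 :: ('c Abasis, 'k) alg2)" by simp
  let ?a = "exchange gA hA :: ('c Abasis, 'k) alg2" and ?b = "exchange hA gA :: ('c Abasis, 'k) alg2"
    and ?c = "exchange hA hA :: ('c Abasis, 'k) alg2"
  have "?a * (?b * ?c) = ?b * (?a * ?c)"
    using exchange_A_commute[of gA hA hA gA] by (simp flip: mult.assoc)
  also have "\<dots> = (?b * ?c) * ?a"
    using exchange_A_commute[of gA hA hA hA] by (simp add: mult.assoc)
  finally have "?a * (?b * ?c) = (?b * ?c) * ?a" .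
  then show "?a * (?b * ?c) * (?a * (?b * ?c)) = 1"
    by (intro square_mult) (simp_all add: sq exchange_A_commute)
qed

text \<open>For \<open>q = 1\<close> the flip interchanges two commuting factors and fixes
  \<open>exchange hA hA\<close>. This symmetry turns rules for the left factor into rules for the
  right one.\<close>

lemma flip_R_q: "flip M = M"
  unfolding M_def
proof (rule R_q_cases[OF two q])
  show "flip (exchange gA hA * (exchange hA gA * exchange hA hA))
      = exchange gA hA * (exchange hA gA * exchange hA hA :: ('c Abasis, 'k) alg2)"
    by (simp add: alg_homD(3)[OF alg_hom_flip] flip_exchange exchange_A_commute[of hA gA gA hA] flip: mult.assoc)
qed (simp add: flip_exchange)

lemma R_q_left: "M * (w \<otimes> 1) = (w \<otimes> 1) * M" if "gA * w = w * gA" "hA * w = w * hA"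
  unfolding M_def
proof (rule R_q_cases[OF two q])
  show "exchange gA hA * (exchange hA gA * exchange hA hA) * (w \<otimes> 1)
      = (w \<otimes> 1) * (exchange gA hA * (exchange hA gA * exchange hA hA))"
    by (simp add: mult.assoc exchange_left[OF that(2)])
       (simp add: exchange_left[OF that(1)] exchange_left[OF that(2)] flip: mult.assoc)
qed (simp add: exchange_left that)

lemma R_q_right: "M * (1 \<otimes> w) = (1 \<otimes> w) * M" if "gA * w = w * gA" "hA * w = w * hA"
proof -
  have "flip (M * (w \<otimes> 1)) = flip ((w \<otimes> 1) * M)"
    by (simp only: R_q_left[OF that])
  then show ?thesis
    by (simp add: alg_homD(3)[OF alg_hom_flip] flip_tensor flip_R_q)
qed

text \<open>\<open>xA\<close> anticommutes with \<open>gA\<close> and \<open>hA\<close>, so each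
  exchange factor contributes its second argument. For \<open>q = 1\<close> these multiply to
  \<open>hA * gA * hA = gA\<close>, the same as for \<open>q = 0\<close>.\<close>

lemma R_q_x_left: "M * (xA \<otimes> 1) = (xA \<otimes> gA) * M"
  unfolding M_def
proof (rule R_q_cases[OF two q])
  let ?a = "exchange gA hA :: ('c Abasis, 'k) alg2" and ?b = "exchange hA gA :: ('c Abasis, 'k) alg2"
    and ?c = "exchange hA hA :: ('c Abasis, 'k) alg2"
  show "exchange gA gA * (xA \<otimes> 1) = (xA \<otimes> gA) * (exchange gA gA :: ('c Abasis, 'k) alg2)"
    by (simp add: exchange_anti_left relations_A)
  have "?b * ?c * (xA \<otimes> 1) = (xA \<otimes> (hA * gA)) * (?b * ?c)"
    by (rule intertwine_left_mult) (simp_all add: exchange_anti_left exchange_right relations_A)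
  then have "?a * (?b * ?c) * (xA \<otimes> 1) = (xA \<otimes> (hA * gA * hA)) * (?a * (?b * ?c))"
    by (intro intertwine_left_mult) (simp_all add: exchange_anti_left exchange_right relations_A flip: mult.assoc)
  then show "?a * (?b * ?c) * (xA \<otimes> 1) = (xA \<otimes> gA) * (?a * (?b * ?c))"
    by (simp add: relations_A(2,4) mult.assoc)
qed

lemma R_q_x_right: "M * (1 \<otimes> xA) = (gA \<otimes> xA) * M"
proof -
  have "flip (M * (xA \<otimes> 1)) = flip ((xA \<otimes> gA) * M)"
    by (simp only: R_q_x_left)
  then show ?thesis
    by (simp add: alg_homD(3)[OF alg_hom_flip] flip_tensor flip_R_q)
qed

lemma R_q_xg: "M * (xA \<otimes> gA) = (xA \<otimes> 1) * M"
proof -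
  have "M * (xA \<otimes> gA) = M * (xA \<otimes> 1) * (1 \<otimes> gA)"
    by (simp add: tensor_mult mult.assoc)
  also have "\<dots> = (xA \<otimes> gA) * (1 \<otimes> gA) * M"
    by (simp add: R_q_x_left) (simp add: mult.assoc R_q_right relations_A)
  also have "(xA \<otimes> gA) * (1 \<otimes> gA) = xA \<otimes> (1 :: ('c Abasis, 'k) alg)"
    by (simp add: tensor_mult relations_A)
  finally show ?thesis .
qed

lemma quasitriangular_R_q: "quasitriangular comult M"
  unfolding quasitriangular_def
proof (intro conjI allI)
  show "\<exists>R'. is_inverse M R'"
    using R_q_square by (auto simp: is_inverse_def)
  show "M * comult u = flip (comult u) * M" for u
  proof (induction u rule: A_induct)
    have group: "M * (w \<otimes> w) = flip (w \<otimes> w) * M" if w: "gA * w = w * gA" "hA * w = w * hA" for w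
    proof -
      have "M * (w \<otimes> w) = M * (w \<otimes> 1) * (1 \<otimes> w)"
        by (simp add: tensor_mult mult.assoc)
      also have "\<dots> = (w \<otimes> 1) * (1 \<otimes> w) * M"
        by (simp add: R_q_left[OF w]) (simp add: mult.assoc R_q_right[OF w])
      finally show ?thesis by (simp add: tensor_mult flip_tensor)
    qed
    { case g show ?case by (simp add: comult_generators group relations_A) }
    { case h show ?case by (simp add: comult_generators group relations_A) }
    { case (grp c) show ?case by (simp add: comult_generators group relations_A) }
    \<comment> \<open>The rules for \<open>1 \<otimes> xA\<close> and \<open>xA \<otimes> gA\<close>
      carry the two terms of the coproduct of \<open>xA\<close> to those of its flip.\<close>
    case x
    show ?case
      by (simp add: comult_generators distrib_left distrib_right alg_linearD[OF alg_linear_flip]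
          flip_tensor R_q_x_right R_q_xg)
  next
    case (mult u v)
    have "M * comult (u * v) = (M * comult u) * comult v"
      by (simp add: alg_homD(3)[OF alg_hom_comult] mult.assoc)
    also have "\<dots> = flip (comult u) * (M * comult v)"
      by (simp only: mult.IH(1) mult.assoc)
    also have "\<dots> = flip (comult (u * v)) * M"
      by (simp only: mult.IH(2) alg_homD(3)[OF alg_hom_comult] alg_homD(3)[OF alg_hom_flip] mult.assoc)
    finally show ?case .
  qed (simp_all add: alg_linearD[OF alg_homD(1)[OF alg_hom_comult]] alg_linearD[OF alg_linear_flip]
      distrib_left distrib_right scale_mult)
qed (use hexagons_R_q in \<open>simp_all add: hexagons_def\<close>)

lemma R_deformation_R_q:
  "R_deformation comult M (xA \<otimes> (gA * xA)) (xA \<otimes> gA \<otimes> (gA * xA))"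
proof
  let ?N = "xA \<otimes> (gA * xA) :: ('c Abasis, 'k) alg2"
  have x: "gA * (gA * u) = u" "xA * (xA * u) = 0" "xA * (gA * u) = - (gA * (xA * u))" "xA * gA = - (gA * xA)"
    for u :: "('c Abasis, 'k) alg"
    by (simp_all add: relations_A flip: mult.assoc)
  have gx: "gA * xA * (gA * xA) = (0 :: ('c Abasis, 'k) alg)"
    by (simp add: mult.assoc x relations_A(3))
  note lin = alg_homD(1)[OF alg_hom_comult]
  show "alg_hom (comult :: ('c Abasis, 'k) comult)" by (rule alg_hom_comult)
  show "quasitriangular comult M" by (rule quasitriangular_R_q)
  show "?N * ?N = 0"
    by (simp add: tensor_mult relations_A tensor_0)
  show "?N * comult u = comult u * ?N" for u
  proof (induction u rule: A_induct)
    case (mult u v)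
    have "?N * comult (u * v) = (?N * comult u) * comult v"
      by (simp add: alg_homD(3)[OF alg_hom_comult] mult.assoc)
    also have "\<dots> = comult u * (?N * comult v)"
      by (simp only: mult.IH(1) mult.assoc)
    also have "\<dots> = comult (u * v) * ?N"
      by (simp only: mult.IH(2) alg_homD(3)[OF alg_hom_comult] mult.assoc)
    finally show ?case .
  next
    \<comment> \<open>\<open>hA\<close> passes one \<open>xA\<close> in each tensor factor, and the
      two signs cancel.\<close>
    case h
    have "xA * (hA * u) = - (hA * (xA * u))" "xA * hA = - (hA * xA :: ('c Abasis, 'k) alg)" "hA * (gA * u) = gA * (hA * u)"
      for u :: "('c Abasis, 'k) alg"
      by (simp_all add: relations_A flip: mult.assoc)
    then show ?case
      by (simp add: comult_generators tensor_mult tensor_neg mult.assoc)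
  next
    case (grp c)
    have "xA * (1 \<otimes> v) = (1 \<otimes> v) * xA" "gA * ((1 \<otimes> v) * u) = (1 \<otimes> v) * (gA * u)" for u :: "('c Abasis, 'k) alg" and v
      by (simp_all add: relations_A flip: mult.assoc)
    then show ?case
      by (simp add: comult_generators tensor_mult mult.assoc)
  qed (simp_all add: comult_generators distrib_left distrib_right scale_mult alg_linearD[OF lin]
      tensor_mult tensor_neg tensor_0 mult.assoc x relations_A(1-3))
  have "comult (gA * xA) = gA \<otimes> (gA * xA) + (gA * xA) \<otimes> (1 :: ('c Abasis, 'k) alg)"
    by (simp add: alg_homD(3)[OF alg_hom_comult] comult_generators distrib_left tensor_mult relations_A(1))
  then show "id_comult comult ?N = leg12 ?N + xA \<otimes> gA \<otimes> (gA * xA)"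
    by (simp add: id_comult_tensor lin leg_tensor tensor_add)
  show "comult_id comult ?N = leg23 ?N + xA \<otimes> gA \<otimes> (gA * xA)"
    by (simp add: comult_id_tensor lin leg_tensor tensor_add comult_generators
        alg_linearD[OF alg_linear_assoc] assoc_tensor)
  \<comment> \<open>Moving \<open>xA\<close> through the second factor produces a \<open>gA\<close>
    in the first, which cancels the one already there. This gives the conjugation by
    \<open>leg23 M\<close>.\<close>
  have "M * (gA \<otimes> (gA * xA)) = M * (gA \<otimes> 1) * ((1 \<otimes> gA) * (1 \<otimes> xA))"
    by (simp add: tensor_mult mult.assoc)
  also have "\<dots> = (gA \<otimes> 1) * (M * (1 \<otimes> gA)) * (1 \<otimes> xA)"
    by (simp add: R_q_left relations_A(4)) (simp only: mult.assoc)
  also have "\<dots> = (gA \<otimes> 1) * (1 \<otimes> gA) * (M * (1 \<otimes> xA))"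
    by (simp add: R_q_right relations_A(4)) (simp only: mult.assoc)
  also have "\<dots> = (gA \<otimes> 1) * (1 \<otimes> gA) * (gA \<otimes> xA) * M"
    by (simp only: R_q_x_right mult.assoc)
  also have "(gA \<otimes> 1) * (1 \<otimes> gA) * (gA \<otimes> xA) = 1 \<otimes> (gA * xA :: ('c Abasis, 'k) alg)"
    by (simp add: tensor_mult relations_A)
  finally have intertwine: "M * (gA \<otimes> (gA * xA)) = (1 \<otimes> (gA * xA)) * M" .
  show "leg13 ?N * leg12 M = leg12 M * (xA \<otimes> gA \<otimes> (gA * xA))"
    "leg13 ?N * leg23 M = leg23 M * (xA \<otimes> gA \<otimes> (gA * xA))"
    by (simp_all add: leg_tensor leg_intertwine[OF R_q_xg] leg_intertwine[OF intertwine])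
  let ?E = "xA \<otimes> gA \<otimes> (gA * xA) :: ('c Abasis, 'k) alg3"
  \<comment> \<open>With \<open>leg12 ?N\<close> the first factor becomes \<open>xA * xA\<close>;
    with \<open>leg23 ?N\<close> the third becomes \<open>(gA * xA)\<close> squared.\<close>
  show "?E * leg12 ?N = 0" "leg12 ?N * ?E = 0" "?E * leg23 ?N = 0" "leg23 ?N * ?E = 0"
    by (simp_all add: leg_tensor tensor_mult tensor_0 relations_A(3) gx)
qed

text \<open>Conjugation by the symmetric involution \<open>M\<close> sends \<open>?N\<close> to
  minus its flip \<open>?N'\<close>. Hence \<open>R_aq a q\<close> times its flip is
  \<open>(1 - scale a ?N') * (1 + scale a ?N') = 1\<close>.\<close>

lemma triangular_R_aq: "triangular comult (R_aq a q :: ('c Abasis, 'k) alg2)"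
proof -
  let ?N = "xA \<otimes> (gA * xA) :: ('c Abasis, 'k) alg2" and ?N' = "(gA * xA) \<otimes> xA :: ('c Abasis, 'k) alg2"
  have R: "R_aq a q = M * (1 + scale a ?N)"
    by (simp add: R_aq_def M_def tensor_one)
  have MNM: "M * ?N * M = - ?N'"
  proof -
    have "M * ?N * M = M * (xA \<otimes> gA) * (1 \<otimes> xA) * M"
      by (simp add: tensor_mult mult.assoc)
    also have "\<dots> = (xA \<otimes> 1) * (M * (1 \<otimes> xA)) * M"
      by (simp only: R_q_xg mult.assoc)
    also have "\<dots> = (xA \<otimes> 1) * (gA \<otimes> xA) * (M * M)"
      by (simp only: R_q_x_right mult.assoc)
    also have "\<dots> = - ?N'"
      by (simp add: R_q_square tensor_mult relations_A tensor_neg)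
    finally show ?thesis .
  qed
  have "M * (1 + scale a ?N) * (M * (1 + scale a ?N'))
      = (M * M + scale a (M * ?N * M)) * (1 + scale a ?N')"
    by (simp add: distrib_left distrib_right scale_mult mult.assoc)
  also have "\<dots> = (1 - scale a ?N') * (1 + scale a ?N')"
    by (simp only: R_q_square MNM scale_neg) simp
  also have "\<dots> = 1"
    by (simp add: algebra_simps scale_mult tensor_mult relations_A tensor_0)
  finally have "M * (1 + scale a ?N) * (M * (1 + scale a ?N')) = 1" .
  then have 1: "R_aq a q * flip (R_aq a q :: ('c Abasis, 'k) alg2) = 1"
    by (simp add: R alg_homD[OF alg_hom_flip] alg_linearD[OF alg_linear_flip] flip_R_q flip_tensor)
  \<comment> \<open>Applying the flip once more gives the inverse on the other side.\<close>
  then have "flip (R_aq a q * flip (R_aq a q :: ('c Abasis, 'k) alg2)) = 1"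
    by (simp add: alg_homD[OF alg_hom_flip])
  then have "flip (R_aq a q) * (R_aq a q :: ('c Abasis, 'k) alg2) = 1"
    by (simp add: alg_homD[OF alg_hom_flip] flip_flip)
  moreover have "quasitriangular comult (R_aq a q :: ('c Abasis, 'k) alg2)"
    unfolding R by (rule R_deformation.quasi[OF R_deformation.deform[OF R_deformation_R_q]])
  ultimately show ?thesis using 1 by (simp add: triangular_def is_inverse_def)
qed

end

theorem corollary5p2:
  fixes n q :: nat and a \<alpha> :: "'k::field"
  fixes R \<chi> :: "('c::{finite, ab_group_add} Abasis, 'k) alg2"
  assumes "CHAR('k) \<noteq> 2"
    and "n \<ge> 2"
    and "\<forall>c::'c. c + c = 0" and "CARD('c) = 2 ^ (n - 2)"
    and "q \<in> {0, 1}"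
    and "R = R_aq a q" and "\<chi> = chi \<alpha>"
  shows "triangular comult R \<and> infinitesimal_R_matrix comult R \<chi> \<and>
    fps_const R * exp_hbar \<chi> = fps_const R * (1 + fps_X * fps_const \<chi>) \<and>
    quasitriangular_hbar comult (fps_const R * exp_hbar \<chi>)"
proof -
  have two: "(2 :: 'k) \<noteq> 0"
  proof
    assume "(2 :: 'k) = 0"
    \<comment> \<open>A divisor of 2 other than 2 is 1, which no field has as its
      characteristic.\<close>
    then have "CHAR('k) dvd 2"
      using of_nat_eq_0_iff_char_dvd[where 'a = 'k, of 2] by simp
    then have "CHAR('k) = 1"
      using assms(1) prime_nat_iff two_is_prime_nat by blast
    then show False by simp
  qed
  have R: "R = R_q q * (1 + scale a (xA \<otimes> (gA * xA)))"
    by (simp add: assms(6) R_aq_def tensor_one)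
  have \<chi>: "\<chi> = scale (- \<alpha>) (xA \<otimes> (gA * xA))"
  proof -
    have "scale (- \<alpha>) u = scale \<alpha> (- u)" for u :: "('c Abasis, 'k) alg2"
      using scale_scale[of \<alpha> "-1" u] by simp
    then show ?thesis
      by (simp add: assms(7) chi_def relations_A(5) tensor_neg)
  qed
  \<comment> \<open>Deforming \<open>R_q\<close> by \<open>a\<close> gives \<open>R\<close>, and
    rescaling by \<open>- \<alpha>\<close> replaces the nilpotent element by \<open>\<chi>\<close>;
    the remaining parameter is the formal variable alone.\<close>
  interpret R_deformation comult R \<chi> "scale (- \<alpha>) (xA \<otimes> gA \<otimes> (gA * xA))"
    unfolding R \<chi>
    by (intro R_deformation.scale R_deformation.deform R_deformation_R_q two assms(5))
  show ?thesis
    using triangular_R_aq[OF two assms(5), of a] infinitesimal quasitriangular_hbar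
    by (simp add: assms(6) exp_hbar_nilpotent[OF nilpotent])
qed

end
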